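(* Let $(X,\mathcal X,m,T,w,\Gamma)$ be a Greg. Then the $\Gamma$-equivariant maps $\pi_\pm:(E,\eta)\to(E_\pm,\eta_\pm)$ are relatively metrically ergodic.
   Context: A Greg is a tuple $(X,\mathcal X,m,T,w,\Gamma)$: $(X,\mathcal X,m)$ standard probability space, $T$ invertible measure preserving, $\Gamma$ locally compact second countable group, $w:X\to\Gamma$ measurable; $w_n$ is the generated cocycle ($w_0=1$, $w_n(x)=w(T^{n-1}x)\cdots w(x)$ for $n>0$, $w_n(x)=w(T^nx)^{-1}\cdots w(T^{-1}x)^{-1}$ for $n<0$). Fix a probability measure $m^1_\Gamma$ equivalent to Haar measure on $\Gamma$; $\tilde m^1$ is the image of $m\times m^1_\Gamma$ under $(x,g)\mapsto(w_n(x)g^{-1})_{n\in\mathbb Z}\in\Gamma^{\mathbb Z}$, and $\tilde m^1_\pm$ its images under restriction to indices $n\ge0$, resp. $n\le-1$. $\Gamma$ acts on these sequence spaces by $g\cdot(\gamma_i)=(\gamma_ig^{-1})$, commuting with the shifts ($\mathbb Z$-shift $(\gamma_i)\mapsto(\gamma_{i+1})$ on $\Gamma^{\mathbb Z}$; $(\gamma_i)_{i\ge0}\mapsto(\gamma_{i+1})_{i\ge0}$ on futures; $(\gamma_i)_{i<0}\mapsto(\gamma_{i-1})_{i<0}$ on pasts). $(E,\eta)$, $(E_+,\eta_+)$, $(E_-,\eta_-)$ are the spaces of ergodic components for the shifts (factors by the $\sigma$-algebras of shift-invariant sets), with induced $\Gamma$-actions, and $\pi_\pm:E\to E_\pm$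 are induced by the restriction maps. A $\Gamma$-map $p:(A,\alpha)\to(B,\beta)$ is relatively metrically ergodic if for every $\Gamma$-equivariant separable metric extension $q:W\to V$ (a Borel $\Gamma$-map between standard Borel $\Gamma$-spaces with a $\Gamma$-invariant Borel function $d$ on $W\times_VW$ restricting to a separable metric on each fiber $q^{-1}(v)$) and $\Gamma$-maps $F:A\to W$, $f:B\to V$ with $q\circ F=f\circ p$ a.e., there is a $\Gamma$-map $\phi:B\to W$ with $F=\phi\circ p$ a.e. *)

theory Defs
  imports "HOL-Probability.Probability"
begin

definition standard_borel :: "'a measure \<Rightarrow> bool" where
  "standard_borel W \<longleftrightarrow>
     (\<exists>X. completely_metrizable_space X \<and> separable_space X \<and>
          space W = topspace X \<and> sets W = sigma_sets (topspace X) {U. openin X U})"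

text \<open>The group is written additively (class group_add, not necessarily abelian).\<close>
definition lcsc_group :: "'g::{group_add,t2_space,second_countable_topology} itself \<Rightarrow> bool" where
  "lcsc_group _ \<longleftrightarrow>
     continuous_on UNIV (\<lambda>p::'g\<times>'g. fst p + snd p) \<and>
     continuous_on UNIV (uminus :: 'g \<Rightarrow> 'g) \<and>
     locally_compact_space (euclidean :: 'g topology)"

definition left_haar :: "'g::{group_add,topological_space} measure \<Rightarrow> bool" where
  "left_haar \<mu> \<longleftrightarrow> sets \<mu> = sets borel \<and>
     (\<forall>g. \<forall>A\<in>sets borel. emeasure \<mu> ((\<lambda>x. g + x) ` A) = emeasure \<mu> A) \<and>
     (\<forall>K. compact K \<longrightarrow> emeasure \<mu> K < \<infinity>) \<and>
     (\<forall>U. open U \<and> U \<noteq> {} \<longrightarrow> 0 < emeasure \<mu> U)"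

definition equivalent_measures :: "'a measure \<Rightarrow> 'a measure \<Rightarrow> bool" where
  "equivalent_measures M N \<longleftrightarrow> sets M = sets N \<and>
     (\<forall>A\<in>sets M. emeasure M A = 0 \<longleftrightarrow> emeasure N A = 0)"

text \<open>w_0 = 1, w_n x = w (T^(n-1) x) ... w x for n > 0,
  w_n x = w (T^n x)^-1 ... w (T^-1 x)^-1 for n < 0 (group written additively;
  Ti is the inverse of T).\<close>
definition cocycle :: "('x \<Rightarrow> 'x) \<Rightarrow> ('x \<Rightarrow> 'x) \<Rightarrow> ('x \<Rightarrow> 'g::group_add) \<Rightarrow> int \<Rightarrow> 'x \<Rightarrow> 'g" where
  "cocycle T Ti w n x =
     (if 0 \<le> n then sum_list (map (\<lambda>k. w ((T ^^ k) x)) (rev [0..<nat n]))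
      else sum_list (map (\<lambda>k. - w ((Ti ^^ k) x)) (rev [1..<nat (- n) + 1])))"

definition seqZ :: "'g::topological_space measure \<Rightarrow> (int \<Rightarrow> 'g) measure" where
  "seqZ G = PiM UNIV (\<lambda>_. G)"

definition seqN :: "'g::topological_space measure \<Rightarrow> (nat \<Rightarrow> 'g) measure" where
  "seqN G = PiM UNIV (\<lambda>_. G)"

definition mtilde :: "'x measure \<Rightarrow> 'g::{group_add,topological_space} measure \<Rightarrow>
     ('x \<Rightarrow> 'x) \<Rightarrow> ('x \<Rightarrow> 'x) \<Rightarrow> ('x \<Rightarrow> 'g) \<Rightarrow> (int \<Rightarrow> 'g) measure" where
  "mtilde m m1 T Ti w = distr (m \<Otimes>\<^sub>M m1) (seqZ borel)
      (\<lambda>(x, g). \<lambda>n. cocycle T Ti w n x - g)"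

text \<open>Futures: (gamma_i)_{i>=0}, coordinate k is gamma_k.
  Pasts: (gamma_i)_{i<=-1}, coordinate k is gamma_{-k-1}.\<close>
definition restr_future :: "(int \<Rightarrow> 'g) \<Rightarrow> (nat \<Rightarrow> 'g)" where
  "restr_future \<gamma> = (\<lambda>k. \<gamma> (int k))"

definition restr_past :: "(int \<Rightarrow> 'g) \<Rightarrow> (nat \<Rightarrow> 'g)" where
  "restr_past \<gamma> = (\<lambda>k. \<gamma> (- int k - 1))"

text \<open>Shift on two-sided sequences; on futures (gamma_i) |-> (gamma_{i+1});
  on pasts (gamma_i)_{i<0} |-> (gamma_{i-1})_{i<0}, which in the coordinates of
  restr_past is again the left shift k |-> k+1.\<close>
definition shiftZ :: "(int \<Rightarrow> 'g) \<Rightarrow> (int \<Rightarrow> 'g)" where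
  "shiftZ \<gamma> = (\<lambda>i. \<gamma> (i + 1))"

definition shiftN :: "(nat \<Rightarrow> 'g) \<Rightarrow> (nat \<Rightarrow> 'g)" where
  "shiftN \<gamma> = (\<lambda>k. \<gamma> (Suc k))"

definition seq_act :: "'g::group_add \<Rightarrow> ('i \<Rightarrow> 'g) \<Rightarrow> ('i \<Rightarrow> 'g)" where
  "seq_act g \<gamma> = (\<lambda>i. \<gamma> i - g)"

text \<open>Space of ergodic components: the factor of M by the sigma-algebra of
  S-invariant measurable sets (point realization on the same underlying set).\<close>
definition invariant_sets :: "'a measure \<Rightarrow> ('a \<Rightarrow> 'a) \<Rightarrow> 'a set set" where
  "invariant_sets M S = {A \<in> sets M. S -` A \<inter> space M = A}"

definition ergodic_components :: "'a measure \<Rightarrow> ('a \<Rightarrow> 'a) \<Rightarrow> 'a measure" where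
  "ergodic_components M S = measure_of (space M) (invariant_sets M S) (emeasure M)"

definition gmap :: "'a measure \<Rightarrow> ('g \<Rightarrow> 'a \<Rightarrow> 'a) \<Rightarrow> 'b measure \<Rightarrow> ('g \<Rightarrow> 'b \<Rightarrow> 'b)
     \<Rightarrow> ('a \<Rightarrow> 'b) \<Rightarrow> bool" where
  "gmap A aA B aB F \<longleftrightarrow> F \<in> A \<rightarrow>\<^sub>M B \<and> (\<forall>g. AE x in A. F (aA g x) = aB g (F x))"

definition borel_gspace :: "('g::{group_add,topological_space} \<Rightarrow> 'w \<Rightarrow> 'w) \<Rightarrow> 'w measure \<Rightarrow> bool" where
  "borel_gspace a W \<longleftrightarrow> standard_borel W \<and>
     (\<lambda>p. a (fst p) (snd p)) \<in> (borel \<Otimes>\<^sub>M W) \<rightarrow>\<^sub>M W \<and>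
     (\<forall>x\<in>space W. a 0 x = x) \<and>
     (\<forall>g h. \<forall>x\<in>space W. a (g + h) x = a g (a h x))"

definition separable_metric_on :: "'w set \<Rightarrow> ('w \<Rightarrow> 'w \<Rightarrow> real) \<Rightarrow> bool" where
  "separable_metric_on S d \<longleftrightarrow>
     (\<forall>x\<in>S. \<forall>y\<in>S. 0 \<le> d x y \<and> d x y = d y x \<and> (d x y = 0 \<longleftrightarrow> x = y)) \<and>
     (\<forall>x\<in>S. \<forall>y\<in>S. \<forall>z\<in>S. d x z \<le> d x y + d y z) \<and>
     (\<exists>D\<subseteq>S. countable D \<and> (\<forall>x\<in>S. \<forall>e>0. \<exists>y\<in>D. d x y < e))"

definition metric_extension :: "'w measure \<Rightarrow> ('g::{group_add,topological_space} \<Rightarrow> 'w \<Rightarrow> 'w) \<Rightarrow>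
     'v measure \<Rightarrow> ('g \<Rightarrow> 'v \<Rightarrow> 'v) \<Rightarrow> ('w \<Rightarrow> 'v) \<Rightarrow> ('w \<Rightarrow> 'w \<Rightarrow> real) \<Rightarrow> bool" where
  "metric_extension W aW V aV q d \<longleftrightarrow>
     borel_gspace aW W \<and> borel_gspace aV V \<and>
     q \<in> W \<rightarrow>\<^sub>M V \<and> (\<forall>g. \<forall>x\<in>space W. q (aW g x) = aV g (q x)) \<and>
     (\<lambda>p. d (fst p) (snd p)) \<in> borel_measurable
        (restrict_space (W \<Otimes>\<^sub>M W) {p \<in> space W \<times> space W. q (fst p) = q (snd p)}) \<and>
     (\<forall>g. \<forall>x\<in>space W. \<forall>y\<in>space W. q x = q y \<longrightarrow> d (aW g x) (aW g y) = d x y) \<and>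
     (\<forall>v\<in>space V. separable_metric_on {x \<in> space W. q x = v} d)"

text \<open>The defining property of relative metric ergodicity of p : (A,aA) -> (B,aB),
  tested against one Gamma-equivariant separable metric extension q : W -> V.
  p is relatively metrically ergodic iff this holds for all such W, V, q, d
  (in a theorem, the universal quantification over W, V and their types is
  expressed by free variables / type variables).\<close>
definition rel_metric_ergodic_wrt :: "'a measure \<Rightarrow> ('g::{group_add,topological_space} \<Rightarrow> 'a \<Rightarrow> 'a) \<Rightarrow>
     'b measure \<Rightarrow> ('g \<Rightarrow> 'b \<Rightarrow> 'b) \<Rightarrow> ('a \<Rightarrow> 'b) \<Rightarrow>
     'w measure \<Rightarrow> ('g \<Rightarrow> 'w \<Rightarrow> 'w) \<Rightarrow> 'v measure \<Rightarrow> ('g \<Rightarrow> 'v \<Rightarrow> 'v) \<Rightarrow>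
     ('w \<Rightarrow> 'v) \<Rightarrow> ('w \<Rightarrow> 'w \<Rightarrow> real) \<Rightarrow> bool" where
  "rel_metric_ergodic_wrt A aA B aB p W aW V aV q d \<longleftrightarrow>
     (metric_extension W aW V aV q d \<longrightarrow>
       (\<forall>F f. gmap A aA W aW F \<and> gmap B aB V aV f \<and> (AE x in A. q (F x) = f (p x)) \<longrightarrow>
          (\<exists>\<phi>. gmap B aB W aW \<phi> \<and> (AE x in A. F x = \<phi> (p x)))))"

end

theory Submission
  imports Defs
begin

text \<open>
  Let \<open>w\<^sub>n\<close> be the cocycle. Since \<open>F\<close> is equivariant, \<open>F (w\<^sub>n(x) g\<^sup>-\<^sup>1)\<^sub>n = g \<Phi>(x)\<close> almost everywhere for a
  function \<open>\<Phi>\<close> of the sequence \<open>(w\<^sub>n(x))\<^sub>n\<close>, and shift invariance of \<open>F\<close> becomes \<open>\<Phi>(T x) = w(x) \<Phi>(x)\<close>. It has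
  to be shown that \<open>\<Phi>\<close> depends only on the future \<open>(w\<^sub>n(x))\<close>, \<open>n \<ge> 0\<close>.

  The conditional law of \<open>\<Phi>\<close> given the future is realised as \<open>Q(future, u)\<close> with \<open>u\<close> uniform and independent.
  As the fibres are separable, finitely many sections \<open>Q(\<sqdot>, u\<^sub>i)\<close> come \<open>\<epsilon>\<close>-close to \<open>\<Phi>\<close> off a set of small
  measure, and which of them is close is decided, up to small measure, by the indices \<open>\<ge> -n\<close> for some \<open>n\<close>.
  Moving this approximation by \<open>T\<^sup>n\<close> and correcting it by \<open>w\<^sub>n(x)\<^sup>-\<^sup>1\<close>, which preserves the fibre metric, turns
  it into a function of the future that is as close to \<open>\<Phi>\<close> as before. Hence \<open>\<Phi>\<close>, and by equality of
  laws also \<open>Q(future, u)\<close>, is a limit of functions of the future, so that \<open>\<Phi> = Q(future, u)\<close>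
  for almost every fixed \<open>u\<close>. Reflecting the index set exchanges \<open>T\<close> and its inverse, which gives the
  statement for the past.
\<close>

section \<open>Standard Borel spaces as retracts of the Cantor space\<close>

text \<open>The fibre metric need not be complete, so approximations by functions of the future need
  not converge inside \<open>W\<close>; and the countable dense subsets of the fibres come without
  any measurable dependence on the fibre. Randomization meets both obstacles: the sections
  \<open>Q (_, u)\<close> are measurable, take values in \<open>W\<close>, come close to \<Phi>
  within its fibre with positive probability, and almost every one of them is the limit sought.
  Equality of laws carries an approximation of \<Phi> over to them. The correction by w_n(x)^-1
  stays a function of the future because w_n(x) is itself the entry of index n. Two repairs surround
  this core. Equivariance of F holds for each group element only off a null set depending on that
  element, so \<Phi> is formed at a generic group element and not at the identity. Maps from a space
  of ergodic components to a standard Borel space are strictly shift-invariant, because points of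
  the target are measurable; the factor found almost everywhere has to be replaced by a strictly
  invariant version.\<close>

lemma borel_measurable_pred_le [measurable (raw)]:
  fixes f g :: "'a \<Rightarrow> real"
  assumes "f \<in> borel_measurable M" "g \<in> borel_measurable M"
  shows "Measurable.pred M (\<lambda>x. f x \<le> g x)"
  using borel_measurable_le[OF assms] by (simp add: pred_def)

definition bits :: "(nat \<Rightarrow> bool) measure" where
  "bits = PiM UNIV (\<lambda>_. count_space UNIV)"

lemma space_bits [simp]: "space bits = UNIV"
  by (simp add: bits_def space_PiM)

lemma measurable_bits_nth: "(\<lambda>b. b k) \<in> bits \<rightarrow>\<^sub>M count_space UNIV"
  unfolding bits_def by measurable

lemma measurable_bitsI:
  assumes "\<And>k. (\<lambda>x. f x k) \<in> M \<rightarrow>\<^sub>M count_space UNIV"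
  shows "f \<in> M \<rightarrow>\<^sub>M bits"
  unfolding bits_def by (rule measurable_PiM_single') (use assms in auto)

text \<open>The inequalities \<open>lip\<close> and \<open>tri\<close> make \<open>y\<close> a
  Katetov function on the points \<open>D n\<close>: it gives the distances to a point of some
  one-point extension. As \<open>y\<close> comes arbitrarily close to 0, that point is a limit of
  points \<open>D n\<close>, which form a Cauchy sequence by \<open>tri\<close>; completeness places
  it in \<open>M\<close>.\<close>

lemma (in Metric_space) point_of_distances:
  assumes "mcomplete" and D: "\<And>n. D n \<in> M"
    and lip: "\<And>n k. y n \<le> y k + d (D n) (D k)" and tri: "\<And>n k. d (D n) (D k) \<le> y n + y k"
    and small: "\<And>k. \<exists>n. y n < 1 / real (Suc k)"
  shows "\<exists>x\<in>M. \<forall>n. d x (D n) = y n"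
proof -
  obtain N where N: "\<And>k. y (N k) < 1 / real (Suc k)"
    using small by metis
  have inv0: "(\<lambda>k. 1 / real (Suc k)) \<longlonglongrightarrow> 0"
    by (rule LIMSEQ_Suc[OF lim_1_over_n])
  have ynn: "0 \<le> y n" for n
    using tri[of n n] nonneg[of "D n" "D n"] by linarith
  have y0: "(\<lambda>k. y (N k)) \<longlonglongrightarrow> 0"
    by (rule tendsto_sandwich[OF _ _ tendsto_const inv0]) (use N in \<open>auto simp: ynn simp del: of_nat_Suc intro!: always_eventually less_imp_le\<close>)
  have "MCauchy (\<lambda>k. D (N k))"
    unfolding MCauchy_def
  proof (intro conjI allI impI)
    show "range (\<lambda>k. D (N k)) \<subseteq> M" using D by auto
    fix e :: real assume "e > 0"
    then have "eventually (\<lambda>k. y (N k) < e / 2) sequentially"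
      using y0 by (intro order_tendstoD(2)) auto
    then obtain K where "\<And>k. k \<ge> K \<Longrightarrow> y (N k) < e / 2"
      by (auto simp: eventually_sequentially)
    then show "\<exists>K. \<forall>n n'. K \<le> n \<longrightarrow> K \<le> n' \<longrightarrow> d (D (N n)) (D (N n')) < e"
      by (intro exI[of _ K] allI impI) (smt (verit) tri field_sum_of_halves)
  qed
  then obtain x where x: "limitin mtopology (\<lambda>k. D (N k)) x sequentially"
    using \<open>mcomplete\<close> unfolding mcomplete_def by blast
  then have xM: "x \<in> M"
    by (simp add: limitin_mspace)
  have dx: "(\<lambda>k. d (D (N k)) x) \<longlonglongrightarrow> 0"
    using x by (simp add: limitin_metric_dist_null)
  have "d x (D n) = y n" for n
  proof -
    have "(\<lambda>k. \<bar>d x (D n) - y n\<bar>) \<longlonglongrightarrow> 0"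
    proof (rule tendsto_sandwich[OF _ _ tendsto_const])
      show "\<forall>\<^sub>F k in sequentially. \<bar>d x (D n) - y n\<bar> \<le> d (D (N k)) x + y (N k)"
      proof (rule always_eventually, rule allI)
        fix k
        have "d x (D n) \<le> d x (D (N k)) + d (D (N k)) (D n)"
             "d (D (N k)) (D n) \<le> d (D (N k)) x + d x (D n)"
          using D xM by (auto intro: triangle)
        then show "\<bar>d x (D n) - y n\<bar> \<le> d (D (N k)) x + y (N k)"
          using tri[of "N k" n] lip[of n "N k"] commute[of x "D (N k)"] commute[of "D n" "D (N k)"]
          by linarith
      qed
      show "(\<lambda>k. d (D (N k)) x + y (N k)) \<longlonglongrightarrow> 0"
        using tendsto_add[OF dx y0] by simp
    qed auto
    then show ?thesis
      by (simp add: LIMSEQ_const_iff)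
  qed
  then show ?thesis using xM by blast
qed

text \<open>The infimum is taken in the extended reals so that it is total and measurable as a
  countable infimum. Bit sequences that are not cuts also receive a value; such values are later
  tested by countably many inequalities.\<close>

definition real_of_cuts :: "(nat \<Rightarrow> bool) \<Rightarrow> real" where
  "real_of_cuts b = real_of_ereal (INF j. if b j then ereal (real_of_rat (from_nat_into UNIV j)) else \<infinity>)"

lemma real_of_cuts: "real_of_cuts (\<lambda>j. x < real_of_rat (from_nat_into UNIV j)) = x"
proof -
  have "(INF j. if x < real_of_rat (from_nat_into UNIV j)
           then ereal (real_of_rat (from_nat_into UNIV j)) else \<infinity>) = ereal x" (is "Inf (range ?f) = _")
  proof (rule antisym)
    show "ereal x \<le> Inf (range ?f)"
      by (rule INF_greatest) auto
    show "Inf (range ?f) \<le> ereal x"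
    proof (rule ereal_le_epsilon2)
      fix e :: real assume "0 < e"
      then obtain r where r: "x < real_of_rat r" "real_of_rat r < x + e"
        using of_rat_dense[of x "x + e"] by auto
      obtain j where j: "r = from_nat_into UNIV j"
        using from_nat_into_surj[of "UNIV :: rat set" r] by auto
      have "Inf (range ?f) \<le> ?f j"
        by (rule INF_lower) simp
      also have "\<dots> \<le> ereal x + ereal e"
        using r j by simp
      finally show "Inf (range ?f) \<le> ereal x + ereal e" .
    qed
  qed
  then show ?thesis
    by (simp add: real_of_cuts_def)
qed

text \<open>The retraction onto the image replaces the usual statement that a standard Borel space is
  Borel isomorphic to a Borel subset of the Cantor space. A point is coded by its distances
  to a dense sequence, and a distance by the rationals above it.\<close>
lemma standard_borel_retract_bits:
  assumes "standard_borel W" and ne: "space W \<noteq> {}"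
  obtains c r where "c \<in> W \<rightarrow>\<^sub>M bits" "r \<in> bits \<rightarrow>\<^sub>M W" "\<And>w. w \<in> space W \<Longrightarrow> r (c w) = w"
proof -
  obtain X where X: "completely_metrizable_space X" "separable_space X"
    and sW: "space W = topspace X" "sets W = sigma_sets (topspace X) {U. openin X U}"
    using assms(1) unfolding standard_borel_def by blast
  obtain M d where Md: "Metric_space M d" "Metric_space.mcomplete M d" and Xd: "X = Metric_space.mtopology M d"
    using X(1) unfolding completely_metrizable_space_def by blast
  interpret Metric_space M d by fact
  have spW: "space W = M" and setsW: "sets W = sigma_sets M {U. openin mtopology U}"
    using sW Xd by auto
  obtain C where C: "countable C" "C \<subseteq> M" "mtopology closure_of C = M"
    using X(2) unfolding separable_space_def Xd by auto
  have "C \<noteq> {}"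
    using C(3) ne spW by force
  define D where "D = from_nat_into C"
  have DM: "D n \<in> M" for n
    using C(2) \<open>C \<noteq> {}\<close> from_nat_into[of C n] by (auto simp: D_def)
  have dense: "\<exists>n. d x (D n) < e" if "x \<in> M" "e > 0" for x e
  proof -
    have "x \<in> mtopology closure_of C" using that C by simp
    then obtain z where z: "z \<in> C" "z \<in> mball x e"
      using \<open>e > 0\<close> unfolding metric_closure_of by blast
    then obtain n where "z = D n"
      using from_nat_into_surj[OF C(1)] unfolding D_def by metis
    then show ?thesis using z by auto
  qed
  have mball_sets: "mball x e \<in> sets W" for x e
    unfolding setsW by (rule sigma_sets.Basic) auto
  define c where "c w i = (d w (D (fst (prod_decode i))) < real_of_rat (from_nat_into UNIV (snd (prod_decode i))))" for w i
  define dist_of where "dist_of n b = real_of_cuts (\<lambda>j. b (prod_encode (n, j)))" for n b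
  have dist_of_c: "dist_of n (c w) = d w (D n)" for w n
    unfolding dist_of_def c_def using real_of_cuts[of "d w (D n)"] by simp
  have dist_meas [measurable]: "dist_of n \<in> borel_measurable bits" for n
    unfolding dist_of_def real_of_cuts_def
    by (intro borel_measurable_real_of_ereal borel_measurable_INF measurable_If)
       (use measurable_bits_nth in \<open>auto simp: pred_def\<close>)
  \<comment> \<open>These are the conditions of \<open>point_of_distances\<close>. They describe the
    sequences of distances to a point of \<open>M\<close> by countably many inequalities, so the
    domain on which \<open>r\<close> decodes is visibly measurable. It may be larger than the image
    of \<open>c\<close>.\<close>
  define P where "P b \<longleftrightarrow> (\<forall>n k. dist_of n b \<le> dist_of k b + d (D n) (D k) \<and>
      d (D n) (D k) \<le> dist_of n b + dist_of k b) \<and> (\<forall>k. \<exists>n. dist_of n b < 1 / real (Suc k))" for b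
  have P_meas [measurable]: "Measurable.pred bits P"
    unfolding P_def by measurable
  obtain w0 where w0: "w0 \<in> M" using ne spW by auto
  define r where "r b = (if P b then SOME x. x \<in> M \<and> (\<forall>n. d x (D n) = dist_of n b) else w0)" for b
  have rP: "r b \<in> M \<and> (\<forall>n. d (r b) (D n) = dist_of n b)" if "P b" for b
  proof -
    have "\<exists>x\<in>M. \<forall>n. d x (D n) = dist_of n b"
      by (rule point_of_distances[OF Md(2) DM]) (use that in \<open>auto simp: P_def\<close>)
    then have "\<exists>x. x \<in> M \<and> (\<forall>n. d x (D n) = dist_of n b)" by blast
    from someI_ex[OF this] show ?thesis using that by (simp add: r_def)
  qed
  have rM: "r b \<in> M" for b
    using rP[of b] w0 by (cases "P b") (auto simp: r_def)
  have uniq: "x = z" if xz: "x \<in> M" "z \<in> M" "\<And>n. d x (D n) = d z (D n)" for x z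
  proof (rule ccontr)
    assume "x \<noteq> z"
    then have "d x z > 0" using that by (simp add: mdist_pos_less)
    then obtain n where "d x (D n) < d x z / 2" using dense[of x "d x z / 2"] xz by auto
    moreover have "d x z \<le> d x (D n) + d (D n) z" using xz(1,2) DM by (intro triangle)
    ultimately show False using xz(3)[of n] commute[of z "D n"] by simp
  qed
  show ?thesis
  proof (rule that)
    show "c \<in> W \<rightarrow>\<^sub>M bits"
    proof (rule measurable_bitsI)
      fix i
      have "{w \<in> space W. c w i} = mball (D (fst (prod_decode i))) (real_of_rat (from_nat_into UNIV (snd (prod_decode i))))"
        using DM by (auto simp: spW c_def commute)
      then have "{w \<in> space W. c w i} \<in> sets W" using mball_sets by simp
      then show "(\<lambda>w. c w i) \<in> W \<rightarrow>\<^sub>M count_space UNIV"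
        by (simp add: pred_def)
    qed
    show "r (c w) = w" if "w \<in> space W" for w
    proof -
      have wM: "w \<in> M" using that spW by simp
      have "P (c w)"
        unfolding P_def dist_of_c
      proof (intro conjI allI)
        fix n k
        show "d w (D n) \<le> d w (D k) + d (D n) (D k)"
          using triangle[OF wM DM[of k] DM[of n]] by (simp add: commute)
        show "d (D n) (D k) \<le> d w (D n) + d w (D k)"
          using triangle[OF DM[of n] wM DM[of k]] by (simp add: commute)
        show "\<exists>n. d w (D n) < 1 / real (Suc k)"
          by (rule dense[OF wM]) simp
      qed
      from rP[OF this] show ?thesis
        by (intro uniq) (auto simp: wM dist_of_c)
    qed
    show "r \<in> bits \<rightarrow>\<^sub>M W"
    proof (rule measurable_sigma_sets[OF setsW])
      show "{U. openin mtopology U} \<subseteq> Pow M"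
        using openin_subset by fastforce
      show "r \<in> space bits \<rightarrow> M" using rM by auto
      fix U assume "U \<in> {U. openin mtopology U}"
      then have U: "openin mtopology U" by simp
      \<comment> \<open>The balls of rational radius around the \<open>D n\<close> that lie in
        \<open>U\<close> form a countable cover of \<open>U\<close>, so \<open>r b \<in> U\<close>
        can be read off from the numbers \<open>dist_of n b\<close>.\<close>
      define I where "I = {(n, a::rat). mball (D n) (real_of_rat a) \<subseteq> U}"
      have cov: "x \<in> U \<longleftrightarrow> (\<exists>(n, a)\<in>I. d x (D n) < real_of_rat a)" if x: "x \<in> M" for x
      proof
        assume "x \<in> U"
        then obtain e where e: "e > 0" "mball x e \<subseteq> U"
          using U by (auto simp: openin_mtopology)
        obtain a where a: "0 < real_of_rat a" "real_of_rat a < e / 2"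
          using of_rat_dense[of 0 "e / 2"] e by auto
        obtain n where n: "d x (D n) < real_of_rat a"
          using dense[OF x a(1)] by blast
        have "mball (D n) (real_of_rat a) \<subseteq> mball x e"
        proof
          fix z assume z: "z \<in> mball (D n) (real_of_rat a)"
          then have "d x z \<le> d x (D n) + d (D n) z"
            using x DM by (intro triangle) auto
          then show "z \<in> mball x e" using z x n a by auto
        qed
        then show "\<exists>(n, a)\<in>I. d x (D n) < real_of_rat a"
          using e n by (auto simp: I_def)
      next
        assume "\<exists>(n, a)\<in>I. d x (D n) < real_of_rat a"
        then show "x \<in> U" using x DM by (auto simp: I_def commute subset_iff)
      qed
      have "r -` U \<inter> space bits = {b \<in> space bits. if P b then \<exists>p\<in>I. dist_of (fst p) b < real_of_rat (snd p) else w0 \<in> U}"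
      proof -
        have "r b \<in> U \<longleftrightarrow> (if P b then \<exists>p\<in>I. dist_of (fst p) b < real_of_rat (snd p) else w0 \<in> U)" for b
        proof (cases "P b")
          case True
          then show ?thesis using cov[OF rM[of b]] rP[of b] by (auto simp: split_beta)
        next
          case False
          then show ?thesis by (simp add: r_def)
        qed
        then show ?thesis by blast
      qed
      also have "\<dots> \<in> sets bits"
        by measurable
      finally show "r -` U \<inter> space bits \<in> sets bits" .
    qed
  qed
qed

text \<open>The code \<open>c\<close> is injective on \<open>space W\<close>, which turns the
  equation into countably many equations between bits.\<close>

lemma standard_borel_eq_measurable:
  assumes W: "standard_borel W" and f: "f \<in> M \<rightarrow>\<^sub>M W" and g: "g \<in> M \<rightarrow>\<^sub>M W"
  shows "Measurable.pred M (\<lambda>x. f x = g x)"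
proof (cases "space W = {}")
  case True
  then have "space M = {}"
    using measurable_space[OF f] by auto
  then show ?thesis by (simp add: pred_def)
next
  case False
  then obtain c r where c: "c \<in> W \<rightarrow>\<^sub>M bits" and r: "\<And>w. w \<in> space W \<Longrightarrow> r (c w) = w"
    using standard_borel_retract_bits[OF W] by metis
  note c [measurable] f [measurable] g [measurable]
  have "f x = g x \<longleftrightarrow> (\<forall>k. c (f x) k = c (g x) k)" if "x \<in> space M" for x
    using r[OF measurable_space[OF f that]] r[OF measurable_space[OF g that]] by (metis ext[of "c (f x)" "c (g x)"])
  moreover have "Measurable.pred M (\<lambda>x. \<forall>k. c (f x) k = c (g x) k)"
    using measurable_compose[OF measurable_compose[OF f c] measurable_bits_nth]
      measurable_compose[OF measurable_compose[OF g c] measurable_bits_nth]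
    by measurable
  ultimately show ?thesis
    by (subst measurable_cong) auto
qed

lemma standard_borel_singleton:
  assumes W: "standard_borel W" and w: "w \<in> space W"
  shows "{w} \<in> sets W"
proof -
  have "Measurable.pred W (\<lambda>x. x = w)"
    by (rule standard_borel_eq_measurable[OF W]) (use w in auto)
  moreover have "{x \<in> space W. x = w} = {w}" using w by auto
  ultimately show ?thesis by (simp add: pred_def)
qed

section \<open>Randomization\<close>

definition unit_uniform :: "real measure" where
  "unit_uniform = uniform_measure lborel {0..<1}"

lemma sets_unit_uniform [simp, measurable_cong]: "sets unit_uniform = sets borel"
  by (simp add: unit_uniform_def)

lemma space_unit_uniform [simp]: "space unit_uniform = UNIV"
  by (simp add: unit_uniform_def)

lemma prob_space_unit_uniform: "prob_space unit_uniform"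
  unfolding unit_uniform_def by (rule prob_space_uniform_measure) auto

lemma emeasure_unit_uniform: "A \<in> sets borel \<Longrightarrow> emeasure unit_uniform A = emeasure lborel ({0..<1} \<inter> A)"
  by (simp add: unit_uniform_def divide_ennreal_def)

text \<open>The latest bit comes first, so that refining a cylinder is a \<open>Cons\<close> and
  statements about cylinders go by induction on lists.\<close>

primrec rev_prefix :: "(nat \<Rightarrow> 'a) \<Rightarrow> nat \<Rightarrow> 'a list" where
  "rev_prefix b 0 = []"
| "rev_prefix b (Suc k) = b k # rev_prefix b k"

lemma length_rev_prefix [simp]: "length (rev_prefix b k) = k"
  by (induction k) auto

lemma rev_prefix_drop: "j \<le> k \<Longrightarrow> rev_prefix b j = drop (k - j) (rev_prefix b k)"
  by (induction k) (auto simp: le_Suc_eq Suc_diff_le)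

lemma measurable_rev_prefix [measurable]: "(\<lambda>b. rev_prefix b k) \<in> bits \<rightarrow>\<^sub>M count_space UNIV"
proof (induction k)
  case (Suc k)
  note Suc[measurable] measurable_bits_nth[of k, measurable]
  show ?case by simp measurable
qed simp

text \<open>The event that bit \<open>k\<close> is set is a countable union of cylinders of length
  \<open>Suc k\<close>, so rectangles over cylinders generate both projections.\<close>

lemma sets_pair_bits:
  "sets (Y \<Otimes>\<^sub>M bits) = sigma_sets (space Y \<times> UNIV)
     {B \<times> {b. rev_prefix b (length s) = s} | B s. B \<in> sets Y}" (is "_ = sigma_sets ?\<Omega> ?E")
proof (rule antisym)
  have E: "?E \<subseteq> Pow ?\<Omega>"
    using sets.sets_into_space by fastforce
  define S where "S = sigma ?\<Omega> ?E"
  have sets_S: "sets S = sigma_sets ?\<Omega> ?E" and space_S: "space S = ?\<Omega>"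
    using E by (auto simp: S_def)
  have inS: "B \<times> {b. rev_prefix b (length s) = s} \<in> sets S" if "B \<in> sets Y" for B s
    unfolding sets_S by (rule sigma_sets.Basic) (use that in auto)
  have fst: "fst \<in> S \<rightarrow>\<^sub>M Y"
  proof (rule measurableI)
    fix B assume B: "B \<in> sets Y"
    then have "fst -` B \<inter> space S = B \<times> {b. rev_prefix b (length []) = []}"
      using sets.sets_into_space[OF B] by (auto simp: space_S)
    then show "fst -` B \<inter> space S \<in> sets S" using inS[OF B, of "[]"] by simp
  qed (auto simp: space_S)
  have snd: "snd \<in> S \<rightarrow>\<^sub>M bits"
  proof (rule measurable_bitsI)
    fix k
    have "{x \<in> space S. snd x k} = (\<Union>s\<in>{s. length s = Suc k \<and> hd s}. space Y \<times> {b. rev_prefix b (length s) = s})"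
      by (force simp: space_S)
    also have "\<dots> \<in> sets S"
      by (rule sets.countable_UN'[OF countableI_type]) (use inS in blast)
    finally show "(\<lambda>x. snd x k) \<in> S \<rightarrow>\<^sub>M count_space UNIV"
      by (simp add: pred_def)
  qed
  have "(\<lambda>x. (fst x, snd x)) \<in> S \<rightarrow>\<^sub>M Y \<Otimes>\<^sub>M bits"
    using fst snd by measurable
  then have "A \<in> sets S" if "A \<in> sets (Y \<Otimes>\<^sub>M bits)" for A
    using measurable_sets[OF _ that, of "\<lambda>x. x" S] sets.sets_into_space[OF that]
    by (simp add: space_S space_pair_measure Int_absorb2)
  then show "sets (Y \<Otimes>\<^sub>M bits) \<subseteq> sigma_sets ?\<Omega> ?E"
    using sets_S by auto
  show "sigma_sets ?\<Omega> ?E \<subseteq> sets (Y \<Otimes>\<^sub>M bits)"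
  proof -
    have "?E \<subseteq> sets (Y \<Otimes>\<^sub>M bits)"
    proof clarify
      fix B and s :: "bool list" assume "B \<in> sets Y"
      moreover have "{b \<in> space bits. rev_prefix b (length s) = s} \<in> sets bits"
        by measurable
      ultimately show "B \<times> {b. rev_prefix b (length s) = s} \<in> sets (Y \<Otimes>\<^sub>M bits)"
        by simp
    qed
    then show ?thesis
      using sets.sigma_sets_subset[of ?E "Y \<Otimes>\<^sub>M bits"] by (simp add: space_pair_measure)
  qed
qed

text \<open>Two cylinders are nested or disjoint, and in the disjoint case the intersection is a
  rectangle over the base \<open>{}\<close>. The generator is therefore intersection-stable and
  determines a finite measure.\<close>

lemma measure_eqI_pair_bits:
  fixes Y :: "'y measure" and M N :: "('y \<times> (nat \<Rightarrow> bool)) measure"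
  assumes sets: "sets M = sets (Y \<Otimes>\<^sub>M bits)" "sets N = sets (Y \<Otimes>\<^sub>M bits)"
    and fin: "emeasure M (space M) \<noteq> \<infinity>"
    and eq: "\<And>B s. B \<in> sets Y \<Longrightarrow> emeasure M (B \<times> {b. rev_prefix b (length s) = s})
               = emeasure N (B \<times> {b. rev_prefix b (length s) = s})"
  shows "M = N"
proof (rule measure_eqI_generator_eq[where A="\<lambda>_. space Y \<times> UNIV"])
  let ?E = "{B \<times> {b. rev_prefix b (length s) = s} | B (s :: bool list). B \<in> sets Y}"
  show "sets M = sigma_sets (space Y \<times> UNIV) ?E" "sets N = sigma_sets (space Y \<times> UNIV) ?E"
    using sets sets_pair_bits by auto
  show "?E \<subseteq> Pow (space Y \<times> UNIV)"
    using sets.sets_into_space by fastforce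
  have *: "\<exists>u. {b. rev_prefix b (length s) = s} \<inter> {b. rev_prefix b (length t) = t}
      = {b. rev_prefix b (length u) = u} \<or>
      {b. rev_prefix b (length s) = s} \<inter> {b. rev_prefix b (length t) = t} = {}"
    for s t :: "bool list"
  proof -
    have "\<exists>u. {b. rev_prefix b (length s) = s} \<inter> {b. rev_prefix b (length t) = t}
      = {b. rev_prefix b (length u) = u} \<or>
      {b. rev_prefix b (length s) = s} \<inter> {b. rev_prefix b (length t) = t} = {}"
      if le: "length s \<le> length t" for s t :: "bool list"
    proof (cases "drop (length t - length s) t = s")
      case True
      then have "{b. rev_prefix b (length s) = s} \<inter> {b. rev_prefix b (length t) = t} = {b. rev_prefix b (length t) = t}"
        using rev_prefix_drop[OF le] by (metis (mono_tags, lifting) Int_absorb1 mem_Collect_eq subsetI)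
      then show ?thesis by blast
    next
      case False
      then have "{b. rev_prefix b (length s) = s} \<inter> {b. rev_prefix b (length t) = t} = {}"
        by (auto simp: rev_prefix_drop[OF le])
      then show ?thesis by blast
    qed
    from this[of s t] this[of t s] show ?thesis
      by (metis Int_commute linear)
  qed
  show "Int_stable ?E"
  proof (rule Int_stableI)
    fix a a' :: "('y \<times> (nat \<Rightarrow> bool)) set" assume "a \<in> ?E" "a' \<in> ?E"
    then obtain B B' and s t :: "bool list" where B: "B \<in> sets Y" "B' \<in> sets Y"
      and a: "a = B \<times> {b. rev_prefix b (length s) = s}" "a' = B' \<times> {b. rev_prefix b (length t) = t}"
      by blast
    obtain u where "{b. rev_prefix b (length s) = s} \<inter> {b. rev_prefix b (length t) = t}
      = {b. rev_prefix b (length u) = u} \<or>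
      {b. rev_prefix b (length s) = s} \<inter> {b. rev_prefix b (length t) = t} = {}" using * by blast
    then have "B \<times> {b. rev_prefix b (length s) = s} \<inter> B' \<times> {b. rev_prefix b (length t) = t}
        = (B \<inter> B') \<times> {b. rev_prefix b (length u) = u}
      \<or> B \<times> {b. rev_prefix b (length s) = s} \<inter> B' \<times> {b. rev_prefix b (length t) = t}
        = {} \<times> {b. rev_prefix b (length u) = u}"
      unfolding Times_Int_Times by auto
    moreover have "B \<inter> B' \<in> sets Y" "{} \<in> sets Y" using B by auto
    ultimately show "a \<inter> a' \<in> ?E"
      unfolding a by blast
  qed
  show "range (\<lambda>_. space Y \<times> UNIV) \<subseteq> ?E"
    by (auto intro!: exI[of _ "space Y"] exI[of _ "[]"])
  have "space M = space Y \<times> UNIV"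
    using sets_eq_imp_space_eq[OF sets(1)] by (simp add: space_pair_measure)
  then show "emeasure M (space Y \<times> UNIV) \<noteq> \<infinity>" using fin by simp
qed (use eq in auto)

text \<open>Radon-Nikodym gives the conditional probability \<open>p s y\<close> that the bits start
  with \<open>s\<close>. The interval [0,1) is cut successively into intervals of these lengths, and
  \<open>Q (y, u)\<close> lists the choices that locate \<open>u\<close>. This is the quantile
  construction for the lexicographic order on the Cantor space; cylinders suffice by
  \<open>measure_eqI_pair_bits\<close>.\<close>

lemma (in prob_space) randomization_bits:
  assumes Z [measurable]: "Z \<in> M \<rightarrow>\<^sub>M Y" and b [measurable]: "b \<in> M \<rightarrow>\<^sub>M bits"
  obtains Q where "Q \<in> Y \<Otimes>\<^sub>M borel \<rightarrow>\<^sub>M bits"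
    "distr M (Y \<Otimes>\<^sub>M bits) (\<lambda>x. (Z x, b x)) =
     distr (M \<Otimes>\<^sub>M unit_uniform) (Y \<Otimes>\<^sub>M bits) (\<lambda>p. (Z (fst p), Q (Z (fst p), snd p)))"
proof -
  define N where "N = distr M Y Z"
  have sets_N [measurable_cong, simp]: "sets N = sets Y"
    by (simp add: N_def)
  interpret N: prob_space N unfolding N_def by (rule prob_space_distr) measurable
  define A where "A s = {x \<in> space M. rev_prefix (b x) (length s) = s}" for s
  have A [measurable]: "A s \<in> sets M" for s
    unfolding A_def by measurable
  define \<nu> where "\<nu> s = distr (density M (indicator (A s))) Y Z" for s
  have \<nu>: "emeasure (\<nu> s) B = emeasure M (A s \<inter> (Z -` B \<inter> space M))" if "B \<in> sets Y" for s B
    using that by (simp add: \<nu>_def emeasure_distr emeasure_density nn_integral_set_ennreal[symmetric]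
        indicator_inter_arith[symmetric])
  have ex: "\<exists>f \<in> borel_measurable N. density N f = \<nu> s" for s
  proof (rule N.Radon_Nikodym)
    show "absolutely_continuous N (\<nu> s)"
      unfolding absolutely_continuous_def
    proof
      fix B assume B: "B \<in> null_sets N"
      have BY: "B \<in> sets Y" and Z0: "emeasure M (Z -` B \<inter> space M) = 0"
        using B by (auto simp: N_def null_sets_def emeasure_distr)
      have "emeasure M (A s \<inter> (Z -` B \<inter> space M)) \<le> emeasure M (Z -` B \<inter> space M)"
        by (rule emeasure_mono[OF Int_lower2 measurable_sets[OF Z BY]])
      then have "emeasure (\<nu> s) B = 0"
        unfolding \<nu>[OF BY] Z0 by simp
      then show "B \<in> null_sets (\<nu> s)"
        using BY by (simp add: null_sets_def) (simp add: \<nu>_def)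
    qed
  qed (simp add: \<nu>_def)
  then obtain p where p [measurable]: "\<And>s. p s \<in> borel_measurable N" and dp: "\<And>s. density N (p s) = \<nu> s"
    by metis
  have p_int: "(\<integral>\<^sup>+ y. p s y * indicator B y \<partial>N) = emeasure M (A s \<inter> (Z -` B \<inter> space M))" if "B \<in> sets Y" for s B
    using \<nu>[OF that, of s] that by (simp add: dp[symmetric] emeasure_density)
  \<comment> \<open>The event \<open>A s\<close> is the disjoint union of its two refinements by the
    next bit, and densities are unique almost everywhere.\<close>
  have p_add: "AE y in N. p s y = p (False # s) y + p (True # s) y" for s
  proof (rule N.density_unique)
    show "density N (p s) = density N (\<lambda>y. p (False # s) y + p (True # s) y)"
    proof (rule measure_eqI)
      fix B assume "B \<in> sets (density N (p s))"
      then have B [measurable]: "B \<in> sets Y" by simp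
      have "emeasure (density N (\<lambda>y. p (False # s) y + p (True # s) y)) B
          = (\<integral>\<^sup>+ y. p (False # s) y * indicator B y \<partial>N) + (\<integral>\<^sup>+ y. p (True # s) y * indicator B y \<partial>N)"
        by (simp add: emeasure_density distrib_right nn_integral_add)
      also have "\<dots> = emeasure M (A (False # s) \<inter> (Z -` B \<inter> space M) \<union> A (True # s) \<inter> (Z -` B \<inter> space M))"
        unfolding p_int[OF B]
      proof (rule plus_emeasure)
        show "A (False # s) \<inter> (Z -` B \<inter> space M) \<inter> (A (True # s) \<inter> (Z -` B \<inter> space M)) = {}"
          by (auto simp: A_def)
      qed measurable
      also have "A (False # s) \<inter> (Z -` B \<inter> space M) \<union> A (True # s) \<inter> (Z -` B \<inter> space M) = A s \<inter> (Z -` B \<inter> space M)"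
        by (auto simp: A_def)
      finally show "emeasure (density N (p s)) B = emeasure (density N (\<lambda>y. p (False # s) y + p (True # s) y)) B"
        using p_int[OF B, of s] by (simp add: emeasure_density)
    qed simp
  qed measurable
  have p_Nil: "AE y in N. p [] y = 1"
  proof (rule N.density_unique)
    show "density N (p []) = density N (\<lambda>y. 1)"
    proof (rule measure_eqI)
      fix B assume "B \<in> sets (density N (p []))"
      then have B [measurable]: "B \<in> sets Y" by simp
      have "A [] = space M" by (auto simp: A_def)
      then show "emeasure (density N (p [])) B = emeasure (density N (\<lambda>y. 1)) B"
        using p_int[OF B, of "[]"] by (simp add: emeasure_density) (simp add: N_def emeasure_distr Int_absorb1)
    qed simp
  qed measurable
  define P where "P s y = enn2real (p s y)" for s y
  have P_meas [measurable]: "P s \<in> borel_measurable Y" for s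
    unfolding P_def by measurable
  \<comment> \<open>\<open>L s y\<close> is the left end of the interval of \<open>s\<close>: the
    refinement by \<open>False\<close> keeps it, the refinement by \<open>True\<close> starts where
    the \<open>False\<close> part ends.\<close>
  define L where "L = rec_list (\<lambda>y. 0) (\<lambda>c s l y. l y + (if c then P (False # s) y else 0))"
  have L_simps: "L [] = (\<lambda>y. 0)" "L (c # s) = (\<lambda>y. L s y + (if c then P (False # s) y else 0))" for c s
    by (auto simp: L_def)
  have L_meas [measurable]: "L s \<in> borel_measurable Y" for s
    by (induction s) (auto simp: L_simps)
  \<comment> \<open>The next bit is \<open>True\<close> when \<open>u\<close> lies at or to the
    right of the cut. The intervals are half-open on the right, as is the support of
    \<open>unit_uniform\<close>.\<close>
  define pre where "pre y u = rec_nat [] (\<lambda>k s. (L s y + P (False # s) y \<le> u) # s)" for y u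
  have pre_simps: "pre y u 0 = []"
    "pre y u (Suc k) = (L (pre y u k) y + P (False # pre y u k) y \<le> u) # pre y u k" for y u k
    by (auto simp: pre_def)
  have pre_meas [measurable]: "(\<lambda>z. pre (fst z) (snd z) k) \<in> Y \<Otimes>\<^sub>M borel \<rightarrow>\<^sub>M count_space UNIV" for k
  proof (induction k)
    case (Suc k)
    have 1: "(\<lambda>z. (L s (fst z) + P (False # s) (fst z) \<le> snd z) # s) \<in> Y \<Otimes>\<^sub>M borel \<rightarrow>\<^sub>M count_space UNIV" for s
      by measurable
    show ?case
      unfolding pre_simps by (rule measurable_compose_countable[OF 1 Suc])
  qed (simp add: pre_simps)
  define Q where "Q z k = hd (pre (fst z) (snd z) (Suc k))" for z k
  have Q_pre: "rev_prefix (Q z) k = pre (fst z) (snd z) k" for z k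
    by (induction k) (auto simp: Q_def pre_simps)
  have Q_meas [measurable]: "Q \<in> Y \<Otimes>\<^sub>M borel \<rightarrow>\<^sub>M bits"
    by (rule measurable_bitsI) (unfold Q_def, measurable)
  have interval: "{0..<1} \<inter> {u. pre y u (length s) = s} = {L s y ..< L s y + P s y}"
    if add: "\<And>s. P s y = P (False # s) y + P (True # s) y" and one: "P [] y = 1" for y s
  proof (induction s)
    case (Cons c s)
    have nn: "P t y \<ge> 0" for t by (simp add: P_def)
    have "{0..<1} \<inter> {u. pre y u (length (c # s)) = c # s}
        = ({0..<1} \<inter> {u. pre y u (length s) = s}) \<inter> {u. (L s y + P (False # s) y \<le> u) = c}"
      by (auto simp: pre_simps)
    also have "\<dots> = {L (c # s) y ..< L (c # s) y + P (c # s) y}"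
      unfolding Cons.IH using add[of s] nn[of "False # s"] nn[of "True # s"] by (cases c) (auto simp: L_simps)
    finally show ?case .
  qed (auto simp: L_simps pre_simps one)
  \<comment> \<open>There are only countably many bit strings, so one null set serves all of them.
    Outside it the lengths are finite, add up and start from 1.\<close>
  have good: "AE y in N. \<forall>s. emeasure unit_uniform {u. pre y u (length s) = s} = p s y"
  proof -
    have "AE y in N. \<forall>s. p s y = p (False # s) y + p (True # s) y"
      using p_add by (subst AE_all_countable) blast
    then show ?thesis
      using p_Nil AE_space[of N]
    proof eventually_elim
      case (elim y)
      have p_split: "p s y = p (False # s) y + p (True # s) y" for s
        using elim(1) by blast
      have fin: "p s y \<le> 1" for s
      proof (induction s)
        case (Cons c s)
        have "p (c # s) y \<le> p s y"
          unfolding p_split[of s] by (cases c) auto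
        then show ?case using Cons.IH by (rule order_trans)
      qed (simp add: elim(2))
      then have fin': "p s y < top" for s
        by (rule le_less_trans) simp
      have Pp: "ennreal (P s y) = p s y" for s
        unfolding P_def by (rule ennreal_enn2real[OF fin'])
      have add: "P s y = P (False # s) y + P (True # s) y" for s
        unfolding P_def p_split[of s] by (rule enn2real_plus[OF fin' fin'])
      have one: "P [] y = 1" by (simp add: P_def elim(2))
      show ?case
      proof
        fix s :: "bool list"
        have y: "y \<in> space Y" using elim(3) sets_eq_imp_space_eq[OF sets_N] by simp
        have "(\<lambda>u. pre y u (length s)) \<in> borel \<rightarrow>\<^sub>M count_space UNIV"
          using measurable_compose[OF measurable_Pair1'[OF y] pre_meas] by simp
        then have "{u \<in> space borel. pre y u (length s) = s} \<in> sets borel"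
          by measurable
        then have "emeasure unit_uniform {u. pre y u (length s) = s} = emeasure lborel {L s y ..< L s y + P s y}"
          by (simp add: emeasure_unit_uniform interval[OF add one])
        also have "\<dots> = p s y"
          using Pp[of s] by (simp add: P_def)
        finally show "emeasure unit_uniform {u. pre y u (length s) = s} = p s y" .
      qed
    qed
  qed
  interpret U: prob_space unit_uniform by (rule prob_space_unit_uniform)
  interpret MU: pair_prob_space M unit_uniform ..
  let ?D = "distr (M \<Otimes>\<^sub>M unit_uniform) (Y \<Otimes>\<^sub>M bits) (\<lambda>p. (Z (fst p), Q (Z (fst p), snd p)))"
  have "distr M (Y \<Otimes>\<^sub>M bits) (\<lambda>x. (Z x, b x)) = ?D"
  proof (rule measure_eqI_pair_bits)
    fix B :: "'b set" and s :: "bool list" assume B [measurable]: "B \<in> sets Y"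
    define C where "C = {b. rev_prefix b (length s) = s}"
    have "{b \<in> space bits. rev_prefix b (length s) = s} \<in> sets bits" by measurable
    then have C [measurable]: "C \<in> sets bits" by (simp add: C_def)
    have "emeasure ?D (B \<times> C) = (\<integral>\<^sup>+ p. indicator (B \<times> C) (Z (fst p), Q (Z (fst p), snd p)) \<partial>(M \<Otimes>\<^sub>M unit_uniform))"
    proof -
      have "emeasure ?D (B \<times> C) = (\<integral>\<^sup>+ z. indicator (B \<times> C) z \<partial>?D)"
        by (rule nn_integral_indicator[symmetric]) simp
      also have "\<dots> = (\<integral>\<^sup>+ p. indicator (B \<times> C) (Z (fst p), Q (Z (fst p), snd p)) \<partial>(M \<Otimes>\<^sub>M unit_uniform))"
        by (rule nn_integral_distr) measurable
      finally show ?thesis .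
    qed
    also have "\<dots> = (\<integral>\<^sup>+ x. (\<integral>\<^sup>+ u. indicator (B \<times> C) (Z x, Q (Z x, u)) \<partial>unit_uniform) \<partial>M)"
      by (subst U.nn_integral_fst[symmetric]) auto
    also have "\<dots> = (\<integral>\<^sup>+ y. (\<integral>\<^sup>+ u. indicator (B \<times> C) (y, Q (y, u)) \<partial>unit_uniform) \<partial>N)"
      unfolding N_def by (subst nn_integral_distr) auto
    also have "\<dots> = (\<integral>\<^sup>+ y. p s y * indicator B y \<partial>N)"
    proof (rule nn_integral_cong_AE)
      show "AE y in N. (\<integral>\<^sup>+ u. indicator (B \<times> C) (y, Q (y, u)) \<partial>unit_uniform) = p s y * indicator B y"
        using good AE_space[of N]
      proof eventually_elim
        case (elim y)
        then have y: "y \<in> space Y" using sets_eq_imp_space_eq[OF sets_N] by simp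
        have "(\<lambda>u. pre y u (length s)) \<in> borel \<rightarrow>\<^sub>M count_space UNIV"
          using measurable_compose[OF measurable_Pair1'[OF y] pre_meas] by simp
        then have m: "{u \<in> space borel. pre y u (length s) = s} \<in> sets borel"
          by measurable
        have "(\<integral>\<^sup>+ u. indicator (B \<times> C) (y, Q (y, u)) \<partial>unit_uniform)
            = (\<integral>\<^sup>+ u. indicator B y * indicator {u. pre y u (length s) = s} u \<partial>unit_uniform)"
          by (rule nn_integral_cong) (auto simp: C_def Q_pre split: split_indicator)
        also have "\<dots> = p s y * indicator B y"
          using m elim by (simp add: nn_integral_cmult mult.commute)
        finally show ?case .
      qed
    qed
    also have "\<dots> = emeasure M (A s \<inter> (Z -` B \<inter> space M))" by (rule p_int[OF B])
    also have "\<dots> = emeasure (distr M (Y \<Otimes>\<^sub>M bits) (\<lambda>x. (Z x, b x))) (B \<times> C)"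
    proof -
      have "emeasure (distr M (Y \<Otimes>\<^sub>M bits) (\<lambda>x. (Z x, b x))) (B \<times> C)
          = emeasure M ((\<lambda>x. (Z x, b x)) -` (B \<times> C) \<inter> space M)"
        by (rule emeasure_distr) measurable
      also have "(\<lambda>x. (Z x, b x)) -` (B \<times> C) \<inter> space M = A s \<inter> (Z -` B \<inter> space M)"
        by (auto simp: A_def C_def)
      finally show ?thesis by simp
    qed
    finally show "emeasure (distr M (Y \<Otimes>\<^sub>M bits) (\<lambda>x. (Z x, b x))) (B \<times> {b. rev_prefix b (length s) = s})
      = emeasure ?D (B \<times> {b. rev_prefix b (length s) = s})"
      by (simp add: C_def)
  next
    have "prob_space (distr M (Y \<Otimes>\<^sub>M bits) (\<lambda>x. (Z x, b x)))"
      by (rule prob_space_distr) measurable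
    then show "emeasure (distr M (Y \<Otimes>\<^sub>M bits) (\<lambda>x. (Z x, b x))) (space (distr M (Y \<Otimes>\<^sub>M bits) (\<lambda>x. (Z x, b x)))) \<noteq> \<infinity>"
      by (simp only: prob_space.emeasure_space_1) simp
  qed auto
  with Q_meas show ?thesis by (rule that)
qed

text \<open>Randomize the code of \<open>\<Phi>\<close> and decode with the retraction
  \<open>r\<close>, which is defined and measurable on all codes, so the values of \<open>Q\<close>
  lie in \<open>W\<close> without exception.\<close>

lemma (in prob_space) randomization:
  assumes W: "standard_borel W" and Z [measurable]: "Z \<in> M \<rightarrow>\<^sub>M Y" and \<Phi> [measurable]: "\<Phi> \<in> M \<rightarrow>\<^sub>M W"
  obtains Q where "Q \<in> Y \<Otimes>\<^sub>M borel \<rightarrow>\<^sub>M W"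
    "distr M (Y \<Otimes>\<^sub>M W) (\<lambda>x. (Z x, \<Phi> x)) =
     distr (M \<Otimes>\<^sub>M unit_uniform) (Y \<Otimes>\<^sub>M W) (\<lambda>p. (Z (fst p), Q (Z (fst p), snd p)))"
proof -
  have "space W \<noteq> {}"
    using measurable_space[OF \<Phi>] not_empty by auto
  then obtain c r where c [measurable]: "c \<in> W \<rightarrow>\<^sub>M bits" and r [measurable]: "r \<in> bits \<rightarrow>\<^sub>M W"
    and rc: "\<And>w. w \<in> space W \<Longrightarrow> r (c w) = w"
    using standard_borel_retract_bits[OF W] by metis
  have "(\<lambda>x. c (\<Phi> x)) \<in> M \<rightarrow>\<^sub>M bits" by measurable
  then obtain Q where Q [measurable]: "Q \<in> Y \<Otimes>\<^sub>M borel \<rightarrow>\<^sub>M bits"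
    and eq: "distr M (Y \<Otimes>\<^sub>M bits) (\<lambda>x. (Z x, c (\<Phi> x))) =
     distr (M \<Otimes>\<^sub>M unit_uniform) (Y \<Otimes>\<^sub>M bits) (\<lambda>p. (Z (fst p), Q (Z (fst p), snd p)))"
    using randomization_bits[OF Z] by blast
  show ?thesis
  proof (rule that)
    show "(\<lambda>p. r (Q p)) \<in> Y \<Otimes>\<^sub>M borel \<rightarrow>\<^sub>M W" by measurable
    have "distr M (Y \<Otimes>\<^sub>M W) (\<lambda>x. (Z x, \<Phi> x)) = distr M (Y \<Otimes>\<^sub>M W) (\<lambda>x. (Z x, r (c (\<Phi> x))))"
      using rc measurable_space[OF \<Phi>] by (intro distr_cong) auto
    also have "\<dots> = distr (distr M (Y \<Otimes>\<^sub>M bits) (\<lambda>x. (Z x, c (\<Phi> x)))) (Y \<Otimes>\<^sub>M W) (\<lambda>p. (fst p, r (snd p)))"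
      by (subst distr_distr) (auto simp: comp_def)
    also have "\<dots> = distr (M \<Otimes>\<^sub>M unit_uniform) (Y \<Otimes>\<^sub>M W) (\<lambda>p. (Z (fst p), r (Q (Z (fst p), snd p))))"
      unfolding eq by (subst distr_distr) (auto simp: comp_def)
    finally show "distr M (Y \<Otimes>\<^sub>M W) (\<lambda>x. (Z x, \<Phi> x)) =
     distr (M \<Otimes>\<^sub>M unit_uniform) (Y \<Otimes>\<^sub>M W) (\<lambda>p. (Z (fst p), r (Q (Z (fst p), snd p))))" .
  qed
qed

section \<open>Approximation and quasi-invariance\<close>

text \<open>The sets that can be approximated contain the algebra and are stable under complements
  and countable unions. For a union, a finite part is already close in measure, and its members are
  approximated separately.\<close>

lemma (in prob_space) approx_by_algebra:
  assumes alg: "algebra (space M) \<A>" and sub: "\<A> \<subseteq> events"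
    and A: "A \<in> sigma_sets (space M) \<A>" and "\<delta> > (0::real)"
  shows "\<exists>B\<in>\<A>. prob (sym_diff A B) < \<delta>"
proof -
  interpret \<A>: algebra "space M" \<A> by fact
  show ?thesis
    using A \<open>\<delta> > 0\<close>
  proof (induction arbitrary: \<delta>)
    case (Basic a)
    then show ?case by (intro bexI[of _ a]) auto
  next
    case Empty
    then show ?case using \<A>.empty_sets by (intro bexI[of _ "{}"]) auto
  next
    case (Compl a)
    then obtain B where B: "B \<in> \<A>" "prob (sym_diff a B) < \<delta>" by blast
    have "a \<subseteq> space M"
      using Compl(1) sub sets.space_closed sigma_sets_into_sp by (metis subset_trans)
    moreover have "B \<subseteq> space M"
      using B sub sets.sets_into_space by blast
    ultimately have "sym_diff (space M - a) (space M - B) = sym_diff a B" by auto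
    then show ?case
      using B \<A>.compl_sets[OF B(1)] by (intro bexI[of _ "space M - B"]) auto
  next
    case (Union a)
    have a [measurable]: "a i \<in> events" for i
      using Union(1) sub sets.sigma_sets_subset by blast
    have "(\<lambda>n. prob (\<Union>i<n. a i)) \<longlonglongrightarrow> prob (\<Union>n. \<Union>i<n. a i)"
      by (rule finite_Lim_measure_incseq) (fastforce simp: incseq_def)+
    moreover have "(\<Union>n. \<Union>i<n. a i) = (\<Union>i. a i)" by auto
    ultimately have "eventually (\<lambda>n. prob (\<Union>i. a i) - \<delta> / 2 < prob (\<Union>i<n. a i)) sequentially"
      using \<open>\<delta> > 0\<close> by (intro order_tendstoD(1)) auto
    then obtain N where N: "prob (\<Union>i. a i) - \<delta> / 2 < prob (\<Union>i<N. a i)"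
      by (auto simp: eventually_sequentially)
    \<comment> \<open>One half of \<open>\<delta>\<close> is spent on truncating the union, the
      other half is shared by \<open>N\<close> sets; \<open>Suc N\<close> keeps the quotient
      positive when \<open>N = 0\<close>.\<close>
    define \<epsilon> where "\<epsilon> = \<delta> / (2 * real (Suc N))"
    have "\<epsilon> > 0" using \<open>\<delta> > 0\<close> by (simp add: \<epsilon>_def)
    then have "\<exists>B\<in>\<A>. prob (sym_diff (a i) B) < \<epsilon>" for i
      using Union(2) by blast
    then obtain B where B: "\<And>i. B i \<in> \<A>" "\<And>i. prob (sym_diff (a i) (B i)) < \<epsilon>"
      by metis
    have Bm [measurable]: "B i \<in> events" for i using B sub by blast
    have "(\<Union>i<N. B i) \<in> \<A>"
      using \<A>.finite_UN[of "{..<N}" B] B by simp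
    moreover have "prob (sym_diff (\<Union>i. a i) (\<Union>i<N. B i)) < \<delta>"
    proof -
      have "prob (sym_diff (\<Union>i. a i) (\<Union>i<N. B i))
          \<le> prob (((\<Union>i. a i) - (\<Union>i<N. a i)) \<union> (\<Union>i<N. sym_diff (a i) (B i)))"
        by (rule finite_measure_mono) auto
      also have "\<dots> \<le> prob ((\<Union>i. a i) - (\<Union>i<N. a i)) + prob (\<Union>i<N. sym_diff (a i) (B i))"
        by (rule measure_Un_le) auto
      also have "prob ((\<Union>i. a i) - (\<Union>i<N. a i)) = prob (\<Union>i. a i) - prob (\<Union>i<N. a i)"
        by (rule finite_measure_Diff) auto
      also have "prob (\<Union>i<N. sym_diff (a i) (B i)) \<le> (\<Sum>i<N. prob (sym_diff (a i) (B i)))"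
        by (rule measure_UNION_le) auto
      also have "(\<Sum>i<N. prob (sym_diff (a i) (B i))) \<le> (\<Sum>i<N. \<epsilon>)"
        by (intro sum_mono less_imp_le B)
      also have "(\<Sum>i<N. \<epsilon>) \<le> \<delta> / 2"
        using \<open>\<delta> > 0\<close> by (simp add: \<epsilon>_def field_simps)
      finally show ?thesis using N by linarith
    qed
    ultimately show ?case by blast
  qed
qed

text \<open>A function cannot exceed its mean everywhere. This is what replaces a random parameter
  by a fixed one that does at least as well as the average.\<close>

lemma (in prob_space) exists_le_nn_integral:
  assumes [measurable]: "G \<in> borel_measurable M" and fin: "(\<integral>\<^sup>+ u. G u \<partial>M) \<noteq> \<infinity>"
  shows "\<exists>u\<in>space M. G u \<le> (\<integral>\<^sup>+ u. G u \<partial>M)"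
proof (rule ccontr)
  let ?a = "\<integral>\<^sup>+ u. G u \<partial>M"
  assume "\<not> (\<exists>u\<in>space M. G u \<le> ?a)"
  then have *: "\<forall>u\<in>space M. ?a < G u" by auto
  have "(\<integral>\<^sup>+ u. ?a \<partial>M) < (\<integral>\<^sup>+ u. G u \<partial>M)"
  proof (rule nn_integral_less)
    show "AE u in M. ?a \<le> G u" using * by (auto intro!: AE_I2 less_imp_le)
    show "\<not> (AE u in M. G u \<le> ?a)"
    proof
      assume "AE u in M. G u \<le> ?a"
      then have "AE u in M. False" using AE_space by eventually_elim (use * in auto)
      then show False by simp
    qed
  qed (use fin in \<open>auto simp: emeasure_space_1\<close>)
  then show False by (simp add: emeasure_space_1)
qed

text \<open>A probability measure equivalent to Haar measure is in general not invariant; left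
  invariance survives as invariance of the null sets.\<close>

locale measurable_group_prob = prob_space m1
  for m1 :: "'g::{group_add,second_countable_topology} measure" +
  assumes sets_m1 [measurable_cong]: "sets m1 = sets borel"
    and measurable_plus: "(\<lambda>p::'g \<times> 'g. fst p + snd p) \<in> borel \<Otimes>\<^sub>M borel \<rightarrow>\<^sub>M borel"
    and measurable_minus: "(uminus :: 'g \<Rightarrow> 'g) \<in> borel \<rightarrow>\<^sub>M borel"
    and left_null: "A \<in> null_sets m1 \<Longrightarrow> (\<lambda>h. g + h) -` A \<in> null_sets m1"
begin

lemma space_m1: "space m1 = UNIV"
  using sets_eq_imp_space_eq[OF sets_m1] by simp

lemma measurable_group_add [measurable (raw)]:
  "f \<in> M \<rightarrow>\<^sub>M borel \<Longrightarrow> g \<in> M \<rightarrow>\<^sub>M borel \<Longrightarrow> (\<lambda>x. f x + g x :: 'g) \<in> M \<rightarrow>\<^sub>M borel"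
  using measurable_compose[OF measurable_Pair measurable_plus, of f M g] by simp

lemma measurable_group_uminus [measurable (raw)]:
  "f \<in> M \<rightarrow>\<^sub>M borel \<Longrightarrow> (\<lambda>x. - f x :: 'g) \<in> M \<rightarrow>\<^sub>M borel"
  by (rule measurable_compose[OF _ measurable_minus])

lemma measurable_group_diff [measurable (raw)]:
  "f \<in> M \<rightarrow>\<^sub>M borel \<Longrightarrow> g \<in> M \<rightarrow>\<^sub>M borel \<Longrightarrow> (\<lambda>x. f x - g x :: 'g) \<in> M \<rightarrow>\<^sub>M borel"
  using measurable_group_add[of f M "\<lambda>x. - g x"] measurable_group_uminus[of g M] by simp

lemma AE_left_translate:
  assumes "AE h in m1. P h"
  shows "AE h in m1. P (g + h)"
proof -
  obtain N where N: "N \<in> null_sets m1" "{h. \<not> P h} \<subseteq> N"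
    using assms by (auto simp: eventually_ae_filter space_m1)
  then show ?thesis
    by (intro AE_I'[OF left_null[OF N(1), of g]]) auto
qed

text \<open>Weil's trick: by Fubini, the set of pairs with -y + x in A is null, and the slice
  over a fixed x is a left translate of -A.\<close>
lemma uminus_null:
  assumes A: "A \<in> null_sets m1"
  shows "uminus -` A \<in> null_sets m1"
proof -
  interpret P: pair_prob_space m1 m1 ..
  have [measurable]: "A \<in> sets borel" using A sets_m1 by auto
  have "AE y in m1. AE x in m1. - y + x \<notin> A"
  proof (rule AE_I2)
    fix y
    have "AE x in m1. x \<notin> A" using A by (rule AE_not_in)
    then show "AE x in m1. - y + x \<notin> A" by (rule AE_left_translate)
  qed
  then have "AE x in m1. AE y in m1. - y + x \<notin> A"
    by (subst P.AE_commute) measurable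
  then obtain x where "AE y in m1. - y + x \<notin> A"
    using eventually_happens'[OF ae_filter_bot] by blast
  then have "AE z in m1. - (x + z) + x \<notin> A" by (rule AE_left_translate)
  then have "AE z in m1. z \<notin> uminus -` A" by (simp add: minus_add add.assoc)
  moreover have "uminus -` A \<in> sets m1"
    using measurable_sets[OF measurable_minus, of A] by (simp add: sets_m1)
  ultimately show ?thesis
    by (subst AE_iff_null_sets) auto
qed

text \<open>Inversion conjugates right translations to left translations and preserves null sets by
  \<open>uminus_null\<close>. Right translations arise because the shift moves the group coordinate
  \<open>h\<close> to \<open>h - w x\<close>.\<close>

lemma AE_right_translate:
  assumes "AE h in m1. P h"
  shows "AE h in m1. P (h + g)"
proof -
  obtain N where N: "N \<in> null_sets m1" "{h. \<not> P h} \<subseteq> N"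
    using assms by (auto simp: eventually_ae_filter space_m1)
  have "uminus -` ((\<lambda>h. - g + h) -` (uminus -` N)) \<in> null_sets m1"
    by (intro uminus_null left_null N)
  also have "uminus -` ((\<lambda>h. - g + h) -` (uminus -` N)) = (\<lambda>h. h + g) -` N"
    by (auto simp: minus_add)
  finally show ?thesis
    using N(2) by (intro AE_I') auto
qed

end

section \<open>Metric extensions\<close>

locale gspace_metric_extension =
  fixes W :: "'w measure" and aW :: "'g::{group_add,topological_space} \<Rightarrow> 'w \<Rightarrow> 'w"
    and V :: "'v measure" and aV q d
  assumes metric_ext: "metric_extension W aW V aV q d"
begin

lemma W_std: "standard_borel W" and V_std: "standard_borel V"
  using metric_ext by (auto simp: metric_extension_def borel_gspace_def)

lemma q_meas [measurable]: "q \<in> W \<rightarrow>\<^sub>M V"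
  using metric_ext by (auto simp: metric_extension_def)

lemma aW_meas: "(\<lambda>p. aW (fst p) (snd p)) \<in> borel \<Otimes>\<^sub>M W \<rightarrow>\<^sub>M W"
  using metric_ext by (auto simp: metric_extension_def borel_gspace_def)

lemma aV_meas: "(\<lambda>p. aV (fst p) (snd p)) \<in> borel \<Otimes>\<^sub>M V \<rightarrow>\<^sub>M V"
  using metric_ext by (auto simp: metric_extension_def borel_gspace_def)

lemma aW_measI [measurable (raw)]:
  "f \<in> M \<rightarrow>\<^sub>M borel \<Longrightarrow> g \<in> M \<rightarrow>\<^sub>M W \<Longrightarrow> (\<lambda>x. aW (f x) (g x)) \<in> M \<rightarrow>\<^sub>M W"
  using measurable_compose[OF measurable_Pair aW_meas, of f M g] by simp

lemma aV_measI [measurable (raw)]: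
  "f \<in> M \<rightarrow>\<^sub>M borel \<Longrightarrow> g \<in> M \<rightarrow>\<^sub>M V \<Longrightarrow> (\<lambda>x. aV (f x) (g x)) \<in> M \<rightarrow>\<^sub>M V"
  using measurable_compose[OF measurable_Pair aV_meas, of f M g] by simp

lemma aW_space: "x \<in> space W \<Longrightarrow> aW g x \<in> space W"
  using measurable_space[OF aW_meas, of "(g, x)"] by (simp add: space_pair_measure)

lemma aW_0: "x \<in> space W \<Longrightarrow> aW 0 x = x"
  and aW_add: "x \<in> space W \<Longrightarrow> aW (g + h) x = aW g (aW h x)"
  and q_aW: "x \<in> space W \<Longrightarrow> q (aW g x) = aV g (q x)"
  using metric_ext by (auto simp: metric_extension_def borel_gspace_def)

lemma aW_uminus_cancel: "x \<in> space W \<Longrightarrow> aW (- g) (aW g x) = x"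
  and aW_cancel_uminus: "x \<in> space W \<Longrightarrow> aW g (aW (- g) x) = x"
  using aW_add[of x "- g" g] aW_add[of x g "- g"] aW_0 by auto

lemma aW_inj: "x \<in> space W \<Longrightarrow> y \<in> space W \<Longrightarrow> aW g x = aW g y \<Longrightarrow> x = y"
  using aW_uminus_cancel by metis

text \<open>Nothing is known of \<open>d\<close> across different fibres. With equality of fibres
  built in, the relation is measurable on all of \<open>W \<times> W\<close> and satisfies the
  triangle inequality without side conditions on fibres.\<close>

definition near :: "real \<Rightarrow> 'w \<Rightarrow> 'w \<Rightarrow> bool" where
  "near e x y \<longleftrightarrow> q x = q y \<and> d x y < e"

lemma pred_near [measurable (raw)]:
  assumes [measurable]: "f \<in> M \<rightarrow>\<^sub>M W" "g \<in> M \<rightarrow>\<^sub>M W"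
  shows "Measurable.pred M (\<lambda>x. near e (f x) (g x))"
proof -
  let ?R = "{p \<in> space W \<times> space W. q (fst p) = q (snd p)}"
  have "Measurable.pred (W \<Otimes>\<^sub>M W) (\<lambda>p. q (fst p) = q (snd p))"
    by (rule standard_borel_eq_measurable[OF V_std]) measurable
  then have R: "?R \<in> sets (W \<Otimes>\<^sub>M W)"
    by (simp add: pred_def space_pair_measure)
  have "(\<lambda>p. d (fst p) (snd p)) \<in> borel_measurable (restrict_space (W \<Otimes>\<^sub>M W) ?R)"
    using metric_ext by (auto simp: metric_extension_def)
  then have "{p \<in> space (restrict_space (W \<Otimes>\<^sub>M W) ?R). d (fst p) (snd p) < e} \<in> sets (restrict_space (W \<Otimes>\<^sub>M W) ?R)"
    by measurable
  then have "{p \<in> space (restrict_space (W \<Otimes>\<^sub>M W) ?R). d (fst p) (snd p) < e} \<in> sets (W \<Otimes>\<^sub>M W)"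
    using R by (subst (asm) sets_restrict_space_iff) (auto simp: space_pair_measure)
  also have "{p \<in> space (restrict_space (W \<Otimes>\<^sub>M W) ?R). d (fst p) (snd p) < e}
      = {p \<in> space (W \<Otimes>\<^sub>M W). near e (fst p) (snd p)}"
    by (auto simp: space_restrict_space space_pair_measure near_def)
  finally have *: "Measurable.pred (W \<Otimes>\<^sub>M W) (\<lambda>p. near e (fst p) (snd p))"
    by (simp add: pred_def)
  have "(\<lambda>x. (f x, g x)) \<in> M \<rightarrow>\<^sub>M W \<Otimes>\<^sub>M W" by measurable
  from measurable_compose[OF this *] show ?thesis by simp
qed

lemma fibre: "v \<in> space V \<Longrightarrow> separable_metric_on {x \<in> space W. q x = v} d"
  using metric_ext by (auto simp: metric_extension_def)

lemma q_space: "x \<in> space W \<Longrightarrow> q x \<in> space V"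
  using measurable_space[OF q_meas] .

lemma near_sym:
  assumes "x \<in> space W" "y \<in> space W" "near e x y" shows "near e y x"
  using assms fibre[OF q_space[OF assms(1)]] unfolding near_def separable_metric_on_def by auto

lemma near_trans:
  assumes "x \<in> space W" "y \<in> space W" "z \<in> space W" "near e x y" "near e' y z"
  shows "near (e + e') x z"
proof -
  have "d x z \<le> d x y + d y z"
    using assms fibre[OF q_space[OF assms(1)]] unfolding near_def separable_metric_on_def by auto
  then show ?thesis using assms by (auto simp: near_def)
qed

lemma near_imp_eq:
  assumes "x \<in> space W" "y \<in> space W" "\<And>n. near (1 / real (Suc n)) x y" shows "x = y"
proof -
  have qq: "q x = q y" and lt: "d x y < 1 / real (Suc n)" for n
    using assms(3) by (auto simp: near_def)
  have m: "0 \<le> d x y" "d x y = 0 \<longleftrightarrow> x = y"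
    using assms qq fibre[OF q_space[OF assms(1)]] unfolding separable_metric_on_def by auto
  have "\<not> 0 < d x y"
  proof
    assume "0 < d x y"
    then obtain n where "1 / real (Suc n) < d x y"
      using nat_approx_posE by metis
    then show False using lt[of n] by simp
  qed
  then show ?thesis using m by auto
qed

lemma near_aW:
  assumes "x \<in> space W" "y \<in> space W" "near e x y" shows "near e (aW g x) (aW g y)"
  using assms metric_ext q_aW unfolding near_def metric_extension_def by auto

lemma near_aW_iff:
  assumes "x \<in> space W" "y \<in> space W" shows "near e (aW g x) (aW g y) \<longleftrightarrow> near e x y"
  using near_aW[of x y e g] near_aW[of "aW g x" "aW g y" e "- g"] assms
  by (auto simp: aW_space aW_uminus_cancel)

lemma countable_dense:
  assumes "v \<in> space V"
  obtains D where "countable D" "D \<subseteq> space W"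
    "\<And>x e. x \<in> space W \<Longrightarrow> q x = v \<Longrightarrow> e > 0 \<Longrightarrow> \<exists>y\<in>D. near e x y"
proof -
  obtain D where "D \<subseteq> {x \<in> space W. q x = v}" "countable D"
    "\<And>x e. x \<in> space W \<Longrightarrow> q x = v \<Longrightarrow> e > 0 \<Longrightarrow> \<exists>y\<in>D. d x y < e"
    using fibre[OF assms] unfolding separable_metric_on_def by auto
  note D = this
  show ?thesis
  proof (rule that[OF D(2)])
    show "D \<subseteq> space W" using D(1) by blast
    fix x and e :: real assume x: "x \<in> space W" "q x = v" "e > 0"
    then obtain y where "y \<in> D" "d x y < e" using D(3) by blast
    then show "\<exists>y\<in>D. near e x y"
      using x D(1) by (intro bexI[of _ y]) (auto simp: near_def)
  qed
qed

end

section \<open>Random sections drawn from a conditional law\<close>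

context prob_space
begin

text \<open>Both sides are the same almost sure statement about the joint law in \<open>law\<close>,
  the right one after Fubini. Properties of \<open>\<Phi>\<close> can thus be checked on
  \<open>Q\<close>, whose randomness is independent, and conversely.\<close>

lemma AE_randomized_iff:
  assumes Z [measurable]: "Z \<in> M \<rightarrow>\<^sub>M Y" and \<Phi> [measurable]: "\<Phi> \<in> M \<rightarrow>\<^sub>M W"
    and Q [measurable]: "Q \<in> Y \<Otimes>\<^sub>M borel \<rightarrow>\<^sub>M W"
    and law: "distr M (Y \<Otimes>\<^sub>M W) (\<lambda>x. (Z x, \<Phi> x)) =
      distr (M \<Otimes>\<^sub>M unit_uniform) (Y \<Otimes>\<^sub>M W) (\<lambda>p. (Z (fst p), Q (Z (fst p), snd p)))"
    and P: "Measurable.pred (Y \<Otimes>\<^sub>M W) (\<lambda>z. P (fst z) (snd z))"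
  shows "(AE x in M. P (Z x) (\<Phi> x)) \<longleftrightarrow> (AE x in M. AE u in unit_uniform. P (Z x) (Q (Z x, u)))"
proof -
  interpret U: prob_space unit_uniform by (rule prob_space_unit_uniform)
  interpret MU: pair_prob_space M unit_uniform ..
  have S: "{z \<in> space (Y \<Otimes>\<^sub>M W). P (fst z) (snd z)} \<in> sets (Y \<Otimes>\<^sub>M W)"
    using P by (simp add: pred_def)
  have "(AE x in M. P (Z x) (\<Phi> x)) \<longleftrightarrow> (AE z in distr M (Y \<Otimes>\<^sub>M W) (\<lambda>x. (Z x, \<Phi> x)). P (fst z) (snd z))"
    by (subst AE_distr_iff[OF _ S]) auto
  also have "\<dots> \<longleftrightarrow> (AE p in M \<Otimes>\<^sub>M unit_uniform. P (Z (fst p)) (Q (Z (fst p), snd p)))"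
    unfolding law by (subst AE_distr_iff[OF _ S]) auto
  also have "\<dots> \<longleftrightarrow> (AE x in M. AE u in unit_uniform. P (Z x) (Q (Z x, u)))"
  proof
    assume "AE p in M \<Otimes>\<^sub>M unit_uniform. P (Z (fst p)) (Q (Z (fst p), snd p))"
    from MU.AE_pair[OF this] show "AE x in M. AE u in unit_uniform. P (Z x) (Q (Z x, u))" by simp
  next
    assume *: "AE x in M. AE u in unit_uniform. P (Z x) (Q (Z x, u))"
    have "(\<lambda>p. (Z (fst p), Q (Z (fst p), snd p))) \<in> M \<Otimes>\<^sub>M unit_uniform \<rightarrow>\<^sub>M Y \<Otimes>\<^sub>M W" by measurable
    from measurable_compose[OF this P]
    have "{p \<in> space (M \<Otimes>\<^sub>M unit_uniform). P (Z (fst p)) (Q (Z (fst p), snd p))} \<in> sets (M \<Otimes>\<^sub>M unit_uniform)"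
      by (simp add: pred_def)
    then show "AE p in M \<Otimes>\<^sub>M unit_uniform. P (Z (fst p)) (Q (Z (fst p), snd p))"
      by (rule MU.AE_pair_measure) (use * in simp)
  qed
  finally show ?thesis .
qed

text \<open>Choosing the points one at a time, each at least as good as the average,
  the part missed by N points has measure at most the integral of the N-th power of the
  conditional probability to miss.\<close>
lemma finite_cover_of_positive_slices:
  assumes R: "Measurable.pred (M \<Otimes>\<^sub>M unit_uniform) (\<lambda>p. R (fst p) (snd p))"
    and pos: "AE x in M. emeasure unit_uniform {u. R x u} \<noteq> 0" and "\<delta> > (0::real)"
  shows "\<exists>us. prob {x \<in> space M. \<forall>u\<in>set us. \<not> R x u} < \<delta>"
proof -
  interpret U: prob_space unit_uniform by (rule prob_space_unit_uniform)
  interpret MU: pair_prob_space M unit_uniform ..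
  have space_MU: "space (M \<Otimes>\<^sub>M unit_uniform) = space M \<times> UNIV"
    by (simp add: space_pair_measure)
  define S where "S = {p \<in> space (M \<Otimes>\<^sub>M unit_uniform). \<not> R (fst p) (snd p)}"
  have S [measurable]: "S \<in> sets (M \<Otimes>\<^sub>M unit_uniform)"
    unfolding S_def using R by measurable
  have Rx [measurable]: "Measurable.pred M (\<lambda>x. R x u)" for u
    using measurable_compose[OF measurable_Pair2'[of u unit_uniform M] R] by simp
  define k where "k x = emeasure unit_uniform (Pair x -` S)" for x
  have k [measurable]: "k \<in> borel_measurable M"
    unfolding k_def by measurable
  have S_Rx: "Pair x -` S = {u. \<not> R x u}" if "x \<in> space M" for x
    using that by (auto simp: S_def space_MU)
  have k_less: "AE x in M. k x < 1"
    using pos AE_space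
  proof eventually_elim
    case (elim x)
    have Sx: "Pair x -` S \<in> U.events" by measurable
    have "{u. R x u} = space unit_uniform - Pair x -` S"
      using S_Rx[OF elim(2)] by auto
    then have "emeasure unit_uniform (space unit_uniform - Pair x -` S) \<noteq> 0" using elim by simp
    then have "U.prob (Pair x -` S) \<noteq> 1"
      using Sx U.prob_compl[OF Sx] by (simp add: U.emeasure_eq_measure)
    then have "U.prob (Pair x -` S) < 1" using U.prob_le_1[of "Pair x -` S"] by linarith
    then show ?case by (simp add: k_def U.emeasure_eq_measure)
  qed
  have k_le: "k x \<le> 1" for x
    unfolding k_def by (rule U.emeasure_le_1)
  \<comment> \<open>The weight \<open>f\<close> makes the induction work: after a parameter is
    chosen, it is multiplied by the indicator of the points still missed.\<close>
  have cover: "\<exists>us. (\<integral>\<^sup>+ x. f x * indicator {x. \<forall>u\<in>set us. \<not> R x u} x \<partial>M) \<le> (\<integral>\<^sup>+ x. f x * k x ^ N \<partial>M)"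
    if "f \<in> borel_measurable M" "\<And>x. f x \<le> 1" for f :: "'a \<Rightarrow> ennreal" and N
    using that
  proof (induction N arbitrary: f)
    case 0
    show ?case by (intro exI[of _ "[]"]) simp
  next
    case (Suc N)
    note f [measurable] = Suc.prems(1)
    let ?G = "\<lambda>u. \<integral>\<^sup>+ x. f x * k x ^ N * indicator S (x, u) \<partial>M"
    have "(\<integral>\<^sup>+ u. ?G u \<partial>unit_uniform) = (\<integral>\<^sup>+ x. \<integral>\<^sup>+ u. f x * k x ^ N * indicator S (x, u) \<partial>unit_uniform \<partial>M)"
      by (rule MU.Fubini') measurable
    also have "\<dots> = (\<integral>\<^sup>+ x. f x * k x ^ N * k x \<partial>M)"
    proof (rule nn_integral_cong)
      fix x assume "x \<in> space M"
      have "(\<integral>\<^sup>+ u. f x * k x ^ N * indicator S (x, u) \<partial>unit_uniform)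
          = (\<integral>\<^sup>+ u. f x * k x ^ N * indicator (Pair x -` S) u \<partial>unit_uniform)"
        by (simp add: indicator_def)
      also have "\<dots> = f x * k x ^ N * k x"
        unfolding k_def by (rule nn_integral_cmult_indicator) measurable
      finally show "(\<integral>\<^sup>+ u. f x * k x ^ N * indicator S (x, u) \<partial>unit_uniform) = f x * k x ^ N * k x" .
    qed
    finally have G: "(\<integral>\<^sup>+ u. ?G u \<partial>unit_uniform) = (\<integral>\<^sup>+ x. f x * k x ^ Suc N \<partial>M)"
      by (simp add: mult_ac)
    have "(\<integral>\<^sup>+ x. f x * k x ^ Suc N \<partial>M) \<le> (\<integral>\<^sup>+ x. 1 \<partial>M)"
    proof (rule nn_integral_mono)
      fix x
      have "f x * k x ^ Suc N \<le> 1 * 1"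
        by (intro mult_mono Suc.prems(2) power_le_one k_le) auto
      then show "f x * k x ^ Suc N \<le> 1" by simp
    qed
    then have fin: "(\<integral>\<^sup>+ u. ?G u \<partial>unit_uniform) \<noteq> \<infinity>"
      unfolding G by (auto simp: emeasure_space_1 top_unique)
    have "?G \<in> borel_measurable unit_uniform" by measurable
    from U.exists_le_nn_integral[OF this fin]
    obtain u where u: "?G u \<le> (\<integral>\<^sup>+ x. f x * k x ^ Suc N \<partial>M)" unfolding G by blast
    let ?f = "\<lambda>x. f x * indicator {x \<in> space M. \<not> R x u} x"
    have "?f \<in> borel_measurable M" by measurable
    moreover have "?f x \<le> 1" for x using Suc.prems(2)[of x] by (auto split: split_indicator)
    ultimately obtain us where us: "(\<integral>\<^sup>+ x. ?f x * indicator {x. \<forall>u\<in>set us. \<not> R x u} x \<partial>M) \<le> (\<integral>\<^sup>+ x. ?f x * k x ^ N \<partial>M)"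
      using Suc.IH by blast
    have "(\<integral>\<^sup>+ x. f x * indicator {x. \<forall>u\<in>set (u # us). \<not> R x u} x \<partial>M) = (\<integral>\<^sup>+ x. ?f x * indicator {x. \<forall>u\<in>set us. \<not> R x u} x \<partial>M)"
      by (rule nn_integral_cong) (auto split: split_indicator)
    also note us
    also have "(\<integral>\<^sup>+ x. ?f x * k x ^ N \<partial>M) = ?G u"
      by (rule nn_integral_cong) (auto simp: S_def space_MU split: split_indicator)
    also note u
    finally show ?case by blast
  qed
  have "(\<lambda>N. \<integral>\<^sup>+ x. k x ^ N \<partial>M) \<longlonglongrightarrow> (\<integral>\<^sup>+ x. 0 \<partial>M)"
  proof (rule nn_integral_dominated_convergence[where w="\<lambda>_. 1"])
    show "AE x in M. (\<lambda>N. k x ^ N) \<longlonglongrightarrow> 0"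
      using k_less
    proof eventually_elim
      case (elim x)
      define r where "r = enn2real (k x)"
      have kr: "k x = ennreal r" using elim by (auto simp: r_def ennreal_enn2real_if)
      have "r \<ge> 0" by (simp add: r_def)
      moreover have "r < 1" using elim kr by simp
      ultimately have "(\<lambda>N. ennreal (r ^ N)) \<longlonglongrightarrow> ennreal 0"
        by (intro tendsto_ennrealI LIMSEQ_power_zero) auto
      then show ?case unfolding kr using \<open>r \<ge> 0\<close> by (simp add: ennreal_power)
    qed
    show "\<And>N. AE x in M. k x ^ N \<le> 1" using power_le_one[OF _ k_le] by auto
  qed (auto simp: emeasure_space_1)
  then have "eventually (\<lambda>N. (\<integral>\<^sup>+ x. k x ^ N \<partial>M) < ennreal \<delta>) sequentially"
    using \<open>\<delta> > 0\<close> by (intro order_tendstoD(2)) auto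
  then obtain N where N: "(\<integral>\<^sup>+ x. k x ^ N \<partial>M) < ennreal \<delta>" by (auto simp: eventually_sequentially)
  obtain us where us: "(\<integral>\<^sup>+ x. 1 * indicator {x. \<forall>u\<in>set us. \<not> R x u} x \<partial>M) \<le> (\<integral>\<^sup>+ x. 1 * k x ^ N \<partial>M)"
    using cover[of "\<lambda>_. 1" N] by auto
  have "emeasure M {x \<in> space M. \<forall>u\<in>set us. \<not> R x u} = (\<integral>\<^sup>+ x. indicator {x \<in> space M. \<forall>u\<in>set us. \<not> R x u} x \<partial>M)"
    by (rule nn_integral_indicator[symmetric]) measurable
  also have "\<dots> = (\<integral>\<^sup>+ x. 1 * indicator {x. \<forall>u\<in>set us. \<not> R x u} x \<partial>M)"
    by (rule nn_integral_cong) (auto split: split_indicator)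
  also have "\<dots> < ennreal \<delta>" using us N by simp
  finally show ?thesis
    using \<open>\<delta> > 0\<close> by (intro exI[of _ us]) (simp add: emeasure_eq_measure ennreal_less_iff)
qed

end

context gspace_metric_extension
begin

text \<open>In a separable metric space almost every point lies in the support of the law that
  generates it. Through \<open>law\<close> the point \<open>\<Phi> x\<close> may be replaced by an
  independent \<open>Q (Z x, u)\<close>; the claim then concerns two draws from one law on a single
  fibre.\<close>

lemma randomized_points_near:
  assumes "prob_space M" and Z [measurable]: "Z \<in> M \<rightarrow>\<^sub>M Y" and \<Phi> [measurable]: "\<Phi> \<in> M \<rightarrow>\<^sub>M W"
    and Q [measurable]: "Q \<in> Y \<Otimes>\<^sub>M borel \<rightarrow>\<^sub>M W"
    and law: "distr M (Y \<Otimes>\<^sub>M W) (\<lambda>x. (Z x, \<Phi> x)) =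
      distr (M \<Otimes>\<^sub>M unit_uniform) (Y \<Otimes>\<^sub>M W) (\<lambda>p. (Z (fst p), Q (Z (fst p), snd p)))"
    and g [measurable]: "g \<in> Y \<rightarrow>\<^sub>M V" and qg: "AE x in M. q (\<Phi> x) = g (Z x)" and "e > 0"
  shows "AE x in M. emeasure unit_uniform {u. near e (\<Phi> x) (Q (Z x, u))} \<noteq> 0"
proof -
  interpret prob_space M by fact
  interpret U: prob_space unit_uniform by (rule prob_space_unit_uniform)
  note AE_iff = AE_randomized_iff[OF Z \<Phi> Q law]
  have "Measurable.pred (Y \<Otimes>\<^sub>M W) (\<lambda>z. q (snd z) = g (fst z))"
    by (rule standard_borel_eq_measurable[OF V_std]) measurable
  then have qQ: "AE x in M. AE u in unit_uniform. q (Q (Z x, u)) = g (Z x)"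
    using AE_iff[of "\<lambda>y w. q w = g y"] qg by simp
  \<comment> \<open>A set in the triple product makes the measure of the slice a measurable function
    of the pair, which the transfer by \<open>AE_iff\<close> demands.\<close>
  define S where "S = {p \<in> space ((Y \<Otimes>\<^sub>M W) \<Otimes>\<^sub>M unit_uniform). near e (snd (fst p)) (Q (fst (fst p), snd p))}"
  have S [measurable]: "S \<in> sets ((Y \<Otimes>\<^sub>M W) \<Otimes>\<^sub>M unit_uniform)"
    unfolding S_def by measurable
  have S_slice: "Pair (y, w) -` S = {u. near e w (Q (y, u))}" if "y \<in> space Y" "w \<in> space W" for y w
    using that by (auto simp: S_def space_pair_measure)
  have slice_meas: "(\<lambda>z. emeasure unit_uniform (Pair z -` S)) \<in> borel_measurable (Y \<Otimes>\<^sub>M W)"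
    by measurable
  have P: "Measurable.pred (Y \<Otimes>\<^sub>M W) (\<lambda>z. emeasure unit_uniform {u. near e (snd z) (Q (fst z, u))} \<noteq> 0)"
  proof (subst measurable_cong)
    fix z assume "z \<in> space (Y \<Otimes>\<^sub>M W)"
    then show "(emeasure unit_uniform {u. near e (snd z) (Q (fst z, u))} \<noteq> 0) = (emeasure unit_uniform (Pair z -` S) \<noteq> 0)"
      using S_slice[of "fst z" "snd z"] by (simp add: space_pair_measure mem_Times_iff)
  next
    show "Measurable.pred (Y \<Otimes>\<^sub>M W) (\<lambda>z. emeasure unit_uniform (Pair z -` S) \<noteq> 0)"
      using slice_meas by measurable
  qed
  have "AE x in M. AE u in unit_uniform. emeasure unit_uniform {u'. near e (Q (Z x, u)) (Q (Z x, u'))} \<noteq> 0"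
    using qQ AE_space
  proof eventually_elim
    case (elim x)
    define y where "y = Z x"
    have y: "y \<in> space Y" using elim measurable_space[OF Z] by (simp add: y_def)
    have Qy [measurable]: "(\<lambda>u. Q (y, u)) \<in> borel \<rightarrow>\<^sub>M W"
      using measurable_compose[OF measurable_Pair1'[OF y] Q] .
    have QW: "Q (y, u) \<in> space W" for u
      using measurable_space[OF Qy] by simp
    have "g y \<in> space V" using measurable_space[OF g y] .
    then obtain D where D: "countable D" "D \<subseteq> space W"
      and dense: "\<And>x e. x \<in> space W \<Longrightarrow> q x = g y \<Longrightarrow> e > 0 \<Longrightarrow> \<exists>z\<in>D. near e x z"
      using countable_dense by blast
    let ?null = "\<lambda>u. emeasure unit_uniform {u'. near e (Q (y, u)) (Q (y, u'))} = 0"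
    \<comment> \<open>Call a parameter bad if its \<open>e\<close>-ball is null. All bad parameters
      whose points are \<open>e / 2\<close>-near \<open>z\<close> have their points in the
      \<open>e\<close>-ball of one bad point \<open>Q (y, u0)\<close>, and this ball is null.
      Countably many \<open>z\<close> then exhaust the fibre.\<close>
    have "AE u in unit_uniform. \<not> (near (e / 2) (Q (y, u)) z \<and> ?null u)" if z: "z \<in> D" for z
    proof (cases "\<exists>u0. near (e / 2) (Q (y, u0)) z \<and> ?null u0")
      case True
      then obtain u0 where u0: "near (e / 2) (Q (y, u0)) z" "?null u0" by blast
      have zW: "z \<in> space W" using z D by blast
      have "Measurable.pred borel (\<lambda>u'. near e (Q (y, u0)) (Q (y, u')))"
        using QW[of u0] by measurable
      then have "{u'. near e (Q (y, u0)) (Q (y, u'))} \<in> null_sets unit_uniform"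
        using u0(2) by (auto simp: null_sets_def pred_def)
      then have "AE u in unit_uniform. \<not> near e (Q (y, u0)) (Q (y, u))"
        by (auto dest: AE_not_in)
      then show ?thesis
      proof eventually_elim
        case (elim u)
        show ?case
        proof
          assume "near (e / 2) (Q (y, u)) z \<and> ?null u"
          then have "near (e / 2) z (Q (y, u))" using near_sym[OF QW zW] by blast
          from near_trans[OF QW zW QW u0(1) this] show False using elim by simp
        qed
      qed
    next
      case False
      then show ?thesis by auto
    qed
    then have "AE u in unit_uniform. \<forall>z\<in>D. \<not> (near (e / 2) (Q (y, u)) z \<and> ?null u)"
      by (simp only: AE_ball_countable[OF D(1)]) blast
    then show ?case
      using elim(1) unfolding y_def[symmetric]
    proof eventually_elim
      case (elim u)
      obtain z where "z \<in> D" "near (e / 2) (Q (y, u)) z"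
        using dense[OF QW elim(2), of "e / 2"] \<open>e > 0\<close> by auto
      then show ?case using elim(1) by blast
    qed
  qed
  then show ?thesis
    using AE_iff[of "\<lambda>y w. emeasure unit_uniform {u. near e w (Q (y, u))} \<noteq> 0"] P by simp
qed

text \<open>Since \<open>(Z, Q)\<close> has the law of \<open>(Z, \<Phi>)\<close>, a function
  \<open>\<Psi>\<close> of \<open>Z\<close> that is near \<open>\<Phi>\<close> is equally near
  \<open>Q (Z, u)\<close>. Hence \<open>\<Phi>\<close> is near \<open>Q (Z, u)\<close> for every
  precision, so the two agree almost everywhere, and Fubini permits fixing \<open>u\<close>. No
  limit of the functions \<open>\<Psi>\<close> is formed.\<close>

lemma factor_of_approximations:
  assumes "prob_space M" and Z [measurable]: "Z \<in> M \<rightarrow>\<^sub>M Y" and \<Phi> [measurable]: "\<Phi> \<in> M \<rightarrow>\<^sub>M W"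
    and Q [measurable]: "Q \<in> Y \<Otimes>\<^sub>M borel \<rightarrow>\<^sub>M W"
    and law: "distr M (Y \<Otimes>\<^sub>M W) (\<lambda>x. (Z x, \<Phi> x)) =
      distr (M \<Otimes>\<^sub>M unit_uniform) (Y \<Otimes>\<^sub>M W) (\<lambda>p. (Z (fst p), Q (Z (fst p), snd p)))"
    and approx: "\<And>e \<delta>::real. e > 0 \<Longrightarrow> \<delta> > 0 \<Longrightarrow>
      \<exists>\<Psi>\<in>Y \<rightarrow>\<^sub>M W. measure M {x \<in> space M. \<not> near e (\<Phi> x) (\<Psi> (Z x))} < \<delta>"
  shows "\<exists>\<phi>\<in>Y \<rightarrow>\<^sub>M W. AE x in M. \<Phi> x = \<phi> (Z x)"
proof -
  interpret prob_space M by fact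
  interpret U: prob_space unit_uniform by (rule prob_space_unit_uniform)
  interpret MU: pair_prob_space M unit_uniform ..
  have \<Phi>W: "\<Phi> x \<in> space W" and ZY: "Z x \<in> space Y" if "x \<in> space M" for x
    using measurable_space[OF \<Phi> that] measurable_space[OF Z that] by auto
  have QW: "Q (Z x, u) \<in> space W" if "x \<in> space M" for x u
    using measurable_space[OF Q, of "(Z x, u)"] ZY[OF that] by (simp add: space_pair_measure)
  have small: "MU.prob {p \<in> space (M \<Otimes>\<^sub>M unit_uniform). \<not> near e (\<Phi> (fst p)) (Q (Z (fst p), snd p))} \<le> \<delta>"
    if "e > 0" "\<delta> > 0" for e \<delta> :: real
  proof -
    have "\<exists>\<Psi>\<in>Y \<rightarrow>\<^sub>M W. prob {x \<in> space M. \<not> near (e / 2) (\<Phi> x) (\<Psi> (Z x))} < \<delta> / 2"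
      by (rule approx) (use \<open>e > 0\<close> \<open>\<delta> > 0\<close> in simp_all)
    then obtain \<Psi> where \<Psi> [measurable]: "\<Psi> \<in> Y \<rightarrow>\<^sub>M W"
      and lt: "prob {x \<in> space M. \<not> near (e / 2) (\<Phi> x) (\<Psi> (Z x))} < \<delta> / 2"
      by blast
    have \<Psi>W: "\<Psi> (Z x) \<in> space W" if "x \<in> space M" for x
      using measurable_space[OF \<Psi> ZY[OF that]] .
    let ?A = "{z \<in> space (Y \<Otimes>\<^sub>M W). \<not> near (e / 2) (snd z) (\<Psi> (fst z))}"
    have A: "?A \<in> sets (Y \<Otimes>\<^sub>M W)" by measurable
    let ?B1 = "{p \<in> space (M \<Otimes>\<^sub>M unit_uniform). \<not> near (e / 2) (\<Phi> (fst p)) (\<Psi> (Z (fst p)))}"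
    let ?B2 = "{p \<in> space (M \<Otimes>\<^sub>M unit_uniform). \<not> near (e / 2) (Q (Z (fst p), snd p)) (\<Psi> (Z (fst p)))}"
    have B1: "MU.prob ?B1 = prob {x \<in> space M. \<not> near (e / 2) (\<Phi> x) (\<Psi> (Z x))}"
    proof -
      have "?B1 = {x \<in> space M. \<not> near (e / 2) (\<Phi> x) (\<Psi> (Z x))} \<times> space unit_uniform"
        by (auto simp: space_pair_measure)
      moreover have "{x \<in> space M. \<not> near (e / 2) (\<Phi> x) (\<Psi> (Z x))} \<in> events" by measurable
      ultimately show ?thesis
        by (simp add: measure_def U.emeasure_pair_measure_Times U.emeasure_space_1[simplified])
    qed
    have B2: "MU.prob ?B2 = prob {x \<in> space M. \<not> near (e / 2) (\<Phi> x) (\<Psi> (Z x))}"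
    proof -
      have "MU.prob ?B2 = measure (distr (M \<Otimes>\<^sub>M unit_uniform) (Y \<Otimes>\<^sub>M W) (\<lambda>p. (Z (fst p), Q (Z (fst p), snd p)))) ?A"
        using ZY QW by (subst measure_distr[OF _ A]) (auto intro!: arg_cong[where f="MU.prob"] simp: space_pair_measure)
      also have "\<dots> = prob {x \<in> space M. \<not> near (e / 2) (\<Phi> x) (\<Psi> (Z x))}"
        unfolding law[symmetric]
        using ZY \<Phi>W by (subst measure_distr[OF _ A]) (auto intro!: arg_cong[where f="prob"] simp: space_pair_measure)
      finally show ?thesis .
    qed
    have "MU.prob {p \<in> space (M \<Otimes>\<^sub>M unit_uniform). \<not> near e (\<Phi> (fst p)) (Q (Z (fst p), snd p))} \<le> MU.prob (?B1 \<union> ?B2)"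
    proof (rule MU.finite_measure_mono)
      show "{p \<in> space (M \<Otimes>\<^sub>M unit_uniform). \<not> near e (\<Phi> (fst p)) (Q (Z (fst p), snd p))} \<subseteq> ?B1 \<union> ?B2"
      proof (rule ccontr)
        assume "\<not> ?thesis"
        then obtain p where p: "p \<in> space (M \<Otimes>\<^sub>M unit_uniform)" "\<not> near e (\<Phi> (fst p)) (Q (Z (fst p), snd p))"
          "near (e / 2) (\<Phi> (fst p)) (\<Psi> (Z (fst p)))" "near (e / 2) (Q (Z (fst p), snd p)) (\<Psi> (Z (fst p)))"
          by auto
        have x: "fst p \<in> space M" using p(1) by (auto simp: space_pair_measure)
        from near_trans[OF \<Phi>W[OF x] \<Psi>W[OF x] QW[OF x] p(3) near_sym[OF QW[OF x] \<Psi>W[OF x] p(4)]] p(2)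
        show False by simp
      qed
    qed measurable
    also have "\<dots> \<le> MU.prob ?B1 + MU.prob ?B2"
      by (rule measure_Un_le; measurable)
    also have "\<dots> \<le> \<delta>" unfolding B1 B2 using lt by simp
    finally show ?thesis .
  qed
  have "AE p in M \<Otimes>\<^sub>M unit_uniform. near (1 / real (Suc n)) (\<Phi> (fst p)) (Q (Z (fst p), snd p))" for n
  proof -
    let ?B = "{p \<in> space (M \<Otimes>\<^sub>M unit_uniform). \<not> near (1 / real (Suc n)) (\<Phi> (fst p)) (Q (Z (fst p), snd p))}"
    have "MU.prob ?B \<le> 0"
      by (rule field_le_epsilon) (use small[of "1 / real (Suc n)"] in auto)
    then have "emeasure (M \<Otimes>\<^sub>M unit_uniform) ?B = 0"
      by (simp add: MU.emeasure_eq_measure measure_le_0_iff)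
    moreover have "?B \<in> sets (M \<Otimes>\<^sub>M unit_uniform)" by measurable
    ultimately show ?thesis by (intro AE_I[of _ _ ?B]) auto
  qed
  then have "AE p in M \<Otimes>\<^sub>M unit_uniform. \<forall>n. near (1 / real (Suc n)) (\<Phi> (fst p)) (Q (Z (fst p), snd p))"
    by (simp only: AE_all_countable) blast
  then have "AE p in M \<Otimes>\<^sub>M unit_uniform. \<Phi> (fst p) = Q (Z (fst p), snd p)"
    using AE_space
  proof eventually_elim
    case (elim p)
    then have "fst p \<in> space M" by (auto simp: space_pair_measure)
    then show ?case using elim(1) by (intro near_imp_eq \<Phi>W QW) auto
  qed
  from MU.AE_pair[OF this] have "AE x in M. AE u in unit_uniform. \<Phi> x = Q (Z x, u)" by simp
  moreover have "Measurable.pred (M \<Otimes>\<^sub>M unit_uniform) (\<lambda>p. \<Phi> (fst p) = Q (Z (fst p), snd p))"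
    by (rule standard_borel_eq_measurable[OF W_std]) measurable
  ultimately have "AE u in unit_uniform. AE x in M. \<Phi> x = Q (Z x, u)"
    by (subst (asm) MU.AE_commute) (auto simp: pred_def split_beta)
  then obtain u where "AE x in M. \<Phi> x = Q (Z x, u)"
    using eventually_happens'[OF U.ae_filter_bot] by blast
  moreover have "(\<lambda>y. Q (y, u)) \<in> Y \<rightarrow>\<^sub>M W" by measurable
  ultimately show ?thesis by (intro bexI[of _ "\<lambda>y. Q (y, u)"])
qed

end

section \<open>The cocycle process\<close>

lemma measurable_funpow: "f \<in> M \<rightarrow>\<^sub>M M \<Longrightarrow> (f ^^ n) \<in> M \<rightarrow>\<^sub>M M"
proof (induction n)
  case (Suc n)
  then show ?case using measurable_comp[of "f ^^ n" M M f M] by simp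
qed (simp add: id_def)

lemma space_seqZ [simp]: "space (seqZ borel) = UNIV" and space_seqN [simp]: "space (seqN borel) = UNIV"
  by (auto simp: seqZ_def seqN_def space_PiM)

lemma measurable_seqZ_nth: "f \<in> M \<rightarrow>\<^sub>M seqZ borel \<Longrightarrow> (\<lambda>x. f x k) \<in> M \<rightarrow>\<^sub>M borel"
  unfolding seqZ_def by (rule measurable_compose[OF _ measurable_component_singleton]) auto

lemma measurable_seqN_nth: "f \<in> M \<rightarrow>\<^sub>M seqN borel \<Longrightarrow> (\<lambda>x. f x k) \<in> M \<rightarrow>\<^sub>M borel"
  unfolding seqN_def by (rule measurable_compose[OF _ measurable_component_singleton]) auto

lemma measurable_seqZI: "(\<And>k. (\<lambda>x. f x k) \<in> M \<rightarrow>\<^sub>M borel) \<Longrightarrow> f \<in> M \<rightarrow>\<^sub>M seqZ borel"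
  unfolding seqZ_def by (rule measurable_PiM_single') auto

lemma measurable_seqNI: "(\<And>k. (\<lambda>x. f x k) \<in> M \<rightarrow>\<^sub>M borel) \<Longrightarrow> f \<in> M \<rightarrow>\<^sub>M seqN borel"
  unfolding seqN_def by (rule measurable_PiM_single') auto

lemma restr_future_meas [measurable]: "restr_future \<in> seqZ borel \<rightarrow>\<^sub>M seqN borel"
  unfolding restr_future_def by (rule measurable_seqNI, rule measurable_seqZ_nth) simp

lemma restr_past_meas [measurable]: "restr_past \<in> seqZ borel \<rightarrow>\<^sub>M seqN borel"
  unfolding restr_past_def by (rule measurable_seqNI, rule measurable_seqZ_nth) simp

lemma shiftZ_meas [measurable]: "shiftZ \<in> seqZ borel \<rightarrow>\<^sub>M seqZ borel"
  unfolding shiftZ_def by (rule measurable_seqZI, rule measurable_seqZ_nth) simp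

lemma shiftN_meas [measurable]: "shiftN \<in> seqN borel \<rightarrow>\<^sub>M seqN borel"
  unfolding shiftN_def by (rule measurable_seqNI, rule measurable_seqN_nth) simp

lemma shiftN_restr_future: "shiftN (restr_future \<gamma>) = restr_future (shiftZ \<gamma>)"
  by (simp add: shiftN_def restr_future_def shiftZ_def add.commute)

lemma seq_act_seq_act: "seq_act g (seq_act h \<gamma>) = seq_act (g + h) \<gamma>"
  by (rule ext) (simp add: seq_act_def diff_add_eq_diff_diff_swap)

lemma seq_act_0 [simp]: "seq_act 0 \<gamma> = \<gamma>"
  by (simp add: seq_act_def)

lemma seq_act_shiftZ: "seq_act g (shiftZ \<gamma>) = shiftZ (seq_act g \<gamma>)"
  and seq_act_shiftN: "seq_act g (shiftN y) = shiftN (seq_act g y)"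
  and seq_act_restr_future: "seq_act g (restr_future \<gamma>) = restr_future (seq_act g \<gamma>)"
  by (auto simp: seq_act_def shiftZ_def shiftN_def restr_future_def)

text \<open>\<open>\<psi>\<close> is the eventual value of \<open>\<phi>\<close> along the shift
  orbit. A sequence and its shift have the same tail of the orbit, which makes the invariance
  strict.\<close>

lemma shiftN_invariant_version:
  assumes W: "standard_borel W" and \<phi> [measurable]: "\<phi> \<in> seqN borel \<rightarrow>\<^sub>M W"
  shows "\<exists>\<psi>\<in>seqN borel \<rightarrow>\<^sub>M W. (\<forall>y. \<psi> (shiftN y) = \<psi> y) \<and>
    (\<forall>y. (\<forall>k. \<phi> ((shiftN ^^ k) y) = \<phi> y) \<longrightarrow> \<psi> y = \<phi> y)"
proof -
  define st where "st K y \<longleftrightarrow> (\<forall>k. \<phi> ((shiftN ^^ (k + K)) y) = \<phi> ((shiftN ^^ K) y))" for K y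
  obtain w0 where w0: "w0 \<in> space W"
    using measurable_space[OF \<phi>] by auto
  \<comment> \<open>The least admissible time is a measurable choice, and the value does not depend
    on the choice. The default \<open>w0\<close> is used on a set that the shift preserves in both
    directions.\<close>
  define \<psi> where "\<psi> y = (if \<exists>K. st K y then \<phi> ((shiftN ^^ (LEAST K. st K y)) y) else w0)" for y
  have shift_k [measurable]: "(shiftN ^^ k) \<in> seqN borel \<rightarrow>\<^sub>M seqN borel" for k
    by (rule measurable_funpow[OF shiftN_meas])
  have [measurable]: "Measurable.pred (seqN borel) (st K)" for K
    unfolding st_def
    by (intro pred_intros_countable standard_borel_eq_measurable[OF W] measurable_compose[OF shift_k \<phi>])
  have \<phi>k: "(\<lambda>y. \<phi> ((shiftN ^^ k) y)) \<in> seqN borel \<rightarrow>\<^sub>M W" for k by measurable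
  have "(\<lambda>y. LEAST K. st K y) \<in> seqN borel \<rightarrow>\<^sub>M count_space UNIV" by measurable
  note [measurable] = measurable_compose_countable[OF \<phi>k this]
  have \<psi>_meas: "\<psi> \<in> seqN borel \<rightarrow>\<^sub>M W"
    unfolding \<psi>_def using w0 by measurable
  have char: "\<psi> y = v" if v: "\<And>k. k \<ge> K \<Longrightarrow> \<phi> ((shiftN ^^ k) y) = v" for y v K
  proof -
    have "st K y" unfolding st_def using v by simp
    then have "st (LEAST K. st K y) y" by (rule LeastI)
    then have "\<phi> ((shiftN ^^ (K + (LEAST K. st K y))) y) = \<phi> ((shiftN ^^ (LEAST K. st K y)) y)"
      unfolding st_def by blast
    then have "\<phi> ((shiftN ^^ (LEAST K. st K y)) y) = v" using v by simp
    then show ?thesis using \<open>st K y\<close> by (auto simp: \<psi>_def)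
  qed
  show ?thesis
  proof (intro bexI[OF _ \<psi>_meas] conjI allI impI)
    fix y
    show "\<psi> (shiftN y) = \<psi> y"
    proof (cases "\<exists>K. st K y")
      case True
      then obtain K where "st K y" by blast
      then have eq: "\<phi> ((shiftN ^^ k) y) = \<phi> ((shiftN ^^ K) y)" if "k \<ge> K" for k
        using that unfolding st_def by (metis le_add_diff_inverse2)
      have "\<psi> y = \<phi> ((shiftN ^^ K) y)" using char[OF eq] by blast
      moreover have "\<phi> ((shiftN ^^ k) (shiftN y)) = \<phi> ((shiftN ^^ K) y)" if "k \<ge> K" for k
        using eq[of "Suc k"] that by (simp add: funpow_swap1)
      then have "\<psi> (shiftN y) = \<phi> ((shiftN ^^ K) y)" by (rule char)
      ultimately show ?thesis by simp
    next
      case False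
      have "\<not> st K (shiftN y)" for K
      proof
        assume "st K (shiftN y)"
        then have "st (Suc K) y" by (simp add: st_def funpow_swap1)
        then show False using False by blast
      qed
      then show ?thesis using False by (simp add: \<psi>_def)
    qed
  next
    fix y assume "\<forall>k. \<phi> ((shiftN ^^ k) y) = \<phi> y"
    then show "\<psi> y = \<phi> y" by (intro char) auto
  qed
qed

text \<open>The inverse \<open>Ti\<close> is a parameter with the same assumptions as
  \<open>T\<close>, so that the locale can be interpreted with the two exchanged.\<close>

locale greg = m: prob_space m + measurable_group_prob m1
  for m :: "'x measure" and m1 :: "'g::{group_add,second_countable_topology} measure" +
  fixes T Ti :: "'x \<Rightarrow> 'x" and w :: "'x \<Rightarrow> 'g"
  assumes T_meas [measurable]: "T \<in> m \<rightarrow>\<^sub>M m" and T_mp: "distr m m T = m"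
    and Ti_meas [measurable]: "Ti \<in> m \<rightarrow>\<^sub>M m" and Ti_mp: "distr m m Ti = m"
    and Ti_T: "x \<in> space m \<Longrightarrow> Ti (T x) = x" and T_Ti: "x \<in> space m \<Longrightarrow> T (Ti x) = x"
    and w_meas [measurable]: "w \<in> borel_measurable m"
begin

definition traj :: "'x \<Rightarrow> int \<Rightarrow> 'g" where
  "traj x n = cocycle T Ti w n x"

definition fut :: "'x \<Rightarrow> nat \<Rightarrow> 'g" where
  "fut x = restr_future (traj x)"

lemmas Tn_meas = measurable_funpow[OF T_meas] and Tin_meas = measurable_funpow[OF Ti_meas]

lemma Tn_space: "x \<in> space m \<Longrightarrow> (T ^^ n) x \<in> space m" and Tin_space: "x \<in> space m \<Longrightarrow> (Ti ^^ n) x \<in> space m"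
  using measurable_space[OF Tn_meas] measurable_space[OF Tin_meas] by auto

lemma Tn_mp: "distr m m (T ^^ n) = m"
proof (induction n)
  case (Suc n)
  have "distr m m (T ^^ Suc n) = distr (distr m m (T ^^ n)) m T"
    by (simp add: distr_distr[OF T_meas Tn_meas])
  then show ?case using Suc T_mp by (simp only:)
qed (simp add: distr_id2 id_def)

lemma Tn_Tin: "x \<in> space m \<Longrightarrow> (T ^^ n) ((Ti ^^ (k + n)) x) = (Ti ^^ k) x"
proof (induction n)
  case (Suc n)
  have "(T ^^ Suc n) ((Ti ^^ (k + Suc n)) x) = (T ^^ n) (T (Ti ((Ti ^^ (k + n)) x)))"
    by (simp add: funpow_swap1)
  also have "T (Ti ((Ti ^^ (k + n)) x)) = (Ti ^^ (k + n)) x"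
    by (rule T_Ti[OF Tin_space[OF Suc.prems]])
  finally show ?case using Suc by simp
qed simp

lemma Tin_Tn: "x \<in> space m \<Longrightarrow> (Ti ^^ n) ((T ^^ n) x) = x"
proof (induction n)
  case (Suc n)
  have "(Ti ^^ Suc n) ((T ^^ Suc n) x) = (Ti ^^ n) (Ti (T ((T ^^ n) x)))"
    by (simp add: funpow_swap1)
  then show ?case using Suc Ti_T[OF Tn_space[OF Suc.prems]] by simp
qed simp

lemma traj_0: "traj x 0 = 0"
  by (simp add: traj_def cocycle_def)

lemma cocycle_nonneg: "cocycle T Ti w (int k) x = sum_list (map (\<lambda>j. w ((T ^^ j) x)) (rev [0..<k]))"
  by (simp add: cocycle_def)

text \<open>The sum is reindexed from 0 to have the shape of \<open>cocycle_nonneg\<close> for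
  \<open>Ti\<close> and the generator \<open>- w (Ti x)\<close>.\<close>

lemma cocycle_nonpos: "cocycle T Ti w (- int k) x = sum_list (map (\<lambda>j. - w ((Ti ^^ Suc j) x)) (rev [0..<k]))"
proof (cases "k = 0")
  case False
  have "rev [1..<k + 1] = map Suc (rev [0..<k])"
    by (simp add: map_Suc_upt[symmetric] rev_map del: upt_Suc)
  then show ?thesis using False by (simp add: cocycle_def comp_def)
qed (simp add: cocycle_def)

text \<open>For \<open>n \<ge> 0\<close> the factor split off is the one at time 0. For
  \<open>n < 0\<close> the product for \<open>T x\<close> has one factor more than that for
  \<open>x\<close>, namely \<open>- w (Ti (T x))\<close>, which cancels against
  \<open>w x\<close>.\<close>

lemma traj_Suc:
  assumes x: "x \<in> space m" shows "traj x (n + 1) = traj (T x) n + w x"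
proof (cases "0 \<le> n")
  case True
  then obtain k where k: "n = int k" using nonneg_int_cases by blast
  have "[0..<Suc k] = 0 # map Suc [0..<k]"
    by (simp add: map_Suc_upt upt_conv_Cons del: upt_Suc)
  then have "traj x (int (Suc k)) = sum_list (map (\<lambda>j. w ((T ^^ Suc j) x)) (rev [0..<k])) + w x"
    unfolding traj_def cocycle_nonneg by (simp add: rev_map comp_def del: upt_Suc)
  also have "sum_list (map (\<lambda>j. w ((T ^^ Suc j) x)) (rev [0..<k])) = traj (T x) (int k)"
    unfolding traj_def cocycle_nonneg by (simp add: funpow_swap1)
  finally show ?thesis by (simp add: k add.commute)
next
  case False
  then obtain k where k: "n = - int (Suc k)" using neg_int_cases[of n] by (metis Suc_pred not_le)
  have u: "[0..<Suc k] = 0 # map Suc [0..<k]"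
    by (simp add: map_Suc_upt upt_conv_Cons del: upt_Suc)
  have "traj (T x) (- int (Suc k)) = sum_list (map (\<lambda>j. - w ((Ti ^^ Suc (Suc j)) (T x))) (rev [0..<k])) + - w (Ti (T x))"
    unfolding traj_def cocycle_nonpos u by (simp add: rev_map comp_def del: upt_Suc)
  also have "sum_list (map (\<lambda>j. - w ((Ti ^^ Suc (Suc j)) (T x))) (rev [0..<k])) = traj x (- int k)"
    unfolding traj_def cocycle_nonpos by (simp add: funpow_swap1 Ti_T[OF x])
  finally show ?thesis using Ti_T[OF x] by (simp add: k)
qed

lemma traj_T: "x \<in> space m \<Longrightarrow> traj (T x) n = traj x (n + 1) - w x"
  by (simp add: traj_Suc)

lemma traj_T_eq: "x \<in> space m \<Longrightarrow> traj (T x) = seq_act (w x) (shiftZ (traj x))"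
  by (auto simp: traj_T seq_act_def shiftZ_def)

lemma traj_1: "x \<in> space m \<Longrightarrow> traj x 1 = w x"
  using traj_Suc[of x 0] by (simp add: traj_0)

lemma traj_Tn:
  assumes x: "x \<in> space m" shows "traj ((T ^^ n) x) k = traj x (k + int n) - traj x (int n)"
proof (induction n arbitrary: k)
  case (Suc n)
  let ?z = "(T ^^ n) x"
  have z: "?z \<in> space m" by (rule Tn_space[OF x])
  have "traj ((T ^^ Suc n) x) k = traj ?z (k + 1) - traj ?z 1"
    using traj_T[OF z] traj_1[OF z] by simp
  also have "\<dots> = traj x (k + 1 + int n) - traj x (1 + int n)"
    unfolding Suc by (simp add: diff_diff_eq2)
  finally show ?case by (simp add: algebra_simps)
qed (simp add: traj_0)

lemma traj_meas [measurable]: "traj \<in> m \<rightarrow>\<^sub>M seqZ borel"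
proof (rule measurable_seqZI)
  fix n
  have sum: "(\<lambda>x. sum_list (map (\<lambda>j. f j x) js)) \<in> borel_measurable m"
    if "\<And>j. f j \<in> borel_measurable m" for f :: "nat \<Rightarrow> 'x \<Rightarrow> 'g" and js
    by (induction js) (use that in \<open>auto intro: measurable_group_add\<close>)
  show "(\<lambda>x. traj x n) \<in> borel_measurable m"
    unfolding traj_def
  proof (cases n rule: int_cases2)
    case (nonneg k)
    show "(\<lambda>x. cocycle T Ti w n x) \<in> borel_measurable m"
      unfolding nonneg cocycle_nonneg by (rule sum[OF measurable_compose[OF Tn_meas w_meas]])
  next
    case (nonpos k)
    show "(\<lambda>x. cocycle T Ti w n x) \<in> borel_measurable m"
      unfolding nonpos cocycle_nonpos
      by (rule sum[OF measurable_group_uminus[OF measurable_compose[OF Tin_meas w_meas]]])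
  qed
qed

lemma fut_meas [measurable]: "fut \<in> m \<rightarrow>\<^sub>M seqN borel"
  unfolding fut_def by measurable

text \<open>This computes the future of \<open>(T ^^ n) x\<close> from that of \<open>x\<close>; the
  subtraction restores the value 0 at the origin.\<close>

definition rebase :: "nat \<Rightarrow> (nat \<Rightarrow> 'g) \<Rightarrow> (nat \<Rightarrow> 'g)" where
  "rebase n y = (\<lambda>k. y (k + n) - y n)"

lemma rebase_meas [measurable]: "rebase n \<in> seqN borel \<rightarrow>\<^sub>M seqN borel"
  unfolding rebase_def
  by (rule measurable_seqNI, intro measurable_group_diff; rule measurable_seqN_nth) simp_all

lemma fut_Tin:
  assumes x: "x \<in> space m"
  shows "fut ((Ti ^^ k) x) = rebase n (fut ((Ti ^^ (k + n)) x))"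
proof
  fix i
  have "traj ((T ^^ n) ((Ti ^^ (k + n)) x)) (int i)
      = traj ((Ti ^^ (k + n)) x) (int i + int n) - traj ((Ti ^^ (k + n)) x) (int n)"
    by (rule traj_Tn[OF Tin_space[OF x]])
  then show "fut ((Ti ^^ k) x) i = rebase n (fut ((Ti ^^ (k + n)) x)) i"
    unfolding Tn_Tin[OF x] by (simp add: fut_def restr_future_def rebase_def)
qed

text \<open>\<open>fut ((Ti ^^ n) x)\<close> carries the same information as the entries of
  \<open>traj x\<close> from index \<open>-n\<close> on. These sigma-algebras increase with
  \<open>n\<close>, so their union is an algebra.\<close>

definition past_algebra :: "'x set set" where
  "past_algebra = {{x \<in> space m. fut ((Ti ^^ n) x) \<in> B} | n B. B \<in> sets (seqN borel)}"

lemma past_algebra_mono: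
  assumes "B \<in> sets (seqN borel)" "n \<le> N"
  shows "\<exists>B'\<in>sets (seqN borel). {x \<in> space m. fut ((Ti ^^ n) x) \<in> B} = {x \<in> space m. fut ((Ti ^^ N) x) \<in> B'}"
proof
  show "rebase (N - n) -` B \<in> sets (seqN borel)"
    using measurable_sets[OF rebase_meas assms(1), of "N - n"] by simp
  show "{x \<in> space m. fut ((Ti ^^ n) x) \<in> B} = {x \<in> space m. fut ((Ti ^^ N) x) \<in> rebase (N - n) -` B}"
    using fut_Tin[where k=n and n="N - n"] assms(2) by (intro Collect_cong conj_cong) simp_all
qed

lemma algebra_past_algebra: "algebra (space m) past_algebra"
  unfolding algebra_iff_Un
proof (intro conjI ballI)
  show "past_algebra \<subseteq> Pow (space m)" by (auto simp: past_algebra_def)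
  show "{} \<in> past_algebra" unfolding past_algebra_def by (rule CollectI, rule exI[of _ 0], rule exI[of _ "{}"]) simp
next
  fix a assume "a \<in> past_algebra"
  then obtain n B where a: "a = {x \<in> space m. fut ((Ti ^^ n) x) \<in> B}" "B \<in> sets (seqN borel)"
    by (auto simp: past_algebra_def)
  then have "space m - a = {x \<in> space m. fut ((Ti ^^ n) x) \<in> space (seqN borel) - B}" by auto
  moreover have "space (seqN borel) - B \<in> sets (seqN borel)" using a by blast
  ultimately show "space m - a \<in> past_algebra" unfolding past_algebra_def by blast
next
  fix a b assume "a \<in> past_algebra" "b \<in> past_algebra"
  then obtain n B n' B' where a: "a = {x \<in> space m. fut ((Ti ^^ n) x) \<in> B}" "B \<in> sets (seqN borel)"
    and b: "b = {x \<in> space m. fut ((Ti ^^ n') x) \<in> B'}" "B' \<in> sets (seqN borel)"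
    by (auto simp: past_algebra_def)
  obtain A where A: "A \<in> sets (seqN borel)" "a = {x \<in> space m. fut ((Ti ^^ (max n n')) x) \<in> A}"
    using past_algebra_mono[OF a(2), of n "max n n'"] a(1) by auto
  obtain A' where A': "A' \<in> sets (seqN borel)" "b = {x \<in> space m. fut ((Ti ^^ (max n n')) x) \<in> A'}"
    using past_algebra_mono[OF b(2), of n' "max n n'"] b(1) by auto
  have "a \<union> b = {x \<in> space m. fut ((Ti ^^ (max n n')) x) \<in> A \<union> A'}" using A A' by auto
  moreover have "A \<union> A' \<in> sets (seqN borel)" using A A' by blast
  ultimately show "a \<union> b \<in> past_algebra" unfolding past_algebra_def by blast
qed

lemma past_algebra_events: "past_algebra \<subseteq> sets m"
proof (rule subsetI)
  fix a assume "a \<in> past_algebra"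
  then obtain n B where a: "a = {x \<in> space m. fut ((Ti ^^ n) x) \<in> B}" "B \<in> sets (seqN borel)"
    by (auto simp: past_algebra_def)
  then show "a \<in> sets m"
    using measurable_sets[OF measurable_compose[OF Tin_meas fut_meas] a(2), of n]
    by (simp add: vimage_def Int_def conj_commute)
qed

text \<open>The entry of index \<open>k\<close> is a difference of two entries of the future of
  \<open>(Ti ^^ n) x\<close> as soon as \<open>k + n \<ge> 0\<close>, and
  \<open>n = \<bar>k\<bar>\<close> achieves this.\<close>

lemma traj_in_sigma_past:
  assumes "D \<in> sets (seqZ borel)"
  shows "{x \<in> space m. traj x \<in> D} \<in> sigma_sets (space m) past_algebra"
proof -
  let ?S = "sigma (space m) past_algebra"
  have sub: "past_algebra \<subseteq> Pow (space m)" by (auto simp: past_algebra_def)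
  have "traj \<in> ?S \<rightarrow>\<^sub>M seqZ borel"
  proof (rule measurable_seqZI)
    fix k
    show "(\<lambda>x. traj x k) \<in> ?S \<rightarrow>\<^sub>M borel"
    proof (rule measurableI)
      fix A :: "'g set" assume A: "A \<in> sets borel"
      define n where "n = nat \<bar>k\<bar>"
      let ?B = "(\<lambda>y. y (nat (k + int n)) - y n) -` A \<inter> space (seqN borel)"
      have "(\<lambda>y :: nat \<Rightarrow> 'g. y (nat (k + int n)) - y n) \<in> seqN borel \<rightarrow>\<^sub>M borel"
        by (intro measurable_group_diff; rule measurable_seqN_nth) simp_all
      then have B: "?B \<in> sets (seqN borel)" using A by (rule measurable_sets)
      have "traj x k = fut ((Ti ^^ n) x) (nat (k + int n)) - fut ((Ti ^^ n) x) n" if x: "x \<in> space m" for x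
      proof -
        have "k + int n \<ge> 0" by (simp add: n_def)
        moreover have "(T ^^ n) ((Ti ^^ n) x) = x" using Tn_Tin[OF x, of n 0] by simp
        moreover have "traj ((T ^^ n) ((Ti ^^ n) x)) k = traj ((Ti ^^ n) x) (k + int n) - traj ((Ti ^^ n) x) (int n)"
          by (rule traj_Tn[OF Tin_space[OF x]])
        ultimately show ?thesis by (simp add: fut_def restr_future_def)
      qed
      then have "(\<lambda>x. traj x k) -` A \<inter> space m = {x \<in> space m. fut ((Ti ^^ n) x) \<in> ?B}" by auto
      also have "\<dots> \<in> past_algebra" unfolding past_algebra_def using B by blast
      finally show "(\<lambda>x. traj x k) -` A \<inter> space ?S \<in> sets ?S" using sub by auto
    qed auto
  qed
  from measurable_sets[OF this assms] show ?thesis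
    using sub by (simp add: vimage_def Int_def conj_commute)
qed

lemma approx_by_past:
  assumes "D \<in> sets (seqZ borel)" "\<delta> > (0::real)"
  shows "\<exists>n B. B \<in> sets (seqN borel) \<and>
    m.prob {x \<in> space m. (traj x \<in> D) \<noteq> (fut ((Ti ^^ n) x) \<in> B)} < \<delta>"
proof -
  obtain A where A: "A \<in> past_algebra" "m.prob (sym_diff {x \<in> space m. traj x \<in> D} A) < \<delta>"
    using m.approx_by_algebra[OF algebra_past_algebra past_algebra_events traj_in_sigma_past[OF assms(1)] assms(2)]
    by blast
  then obtain n B where B: "A = {x \<in> space m. fut ((Ti ^^ n) x) \<in> B}" "B \<in> sets (seqN borel)"
    by (auto simp: past_algebra_def)
  have "sym_diff {x \<in> space m. traj x \<in> D} A = {x \<in> space m. (traj x \<in> D) \<noteq> (fut ((Ti ^^ n) x) \<in> B)}"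
    using B by auto
  then show ?thesis using A B by auto
qed

end

lemma (in greg) AE_Tn: "AE z in m. P z \<Longrightarrow> AE x in m. P ((T ^^ n) x)"
  by (rule AE_distrD[OF Tn_meas, unfolded Tn_mp])

lemma (in greg) seq_act_meas [measurable (raw)]:
  fixes f :: "'a \<Rightarrow> 'g"
  assumes "f \<in> M \<rightarrow>\<^sub>M borel" "g \<in> M \<rightarrow>\<^sub>M seqZ borel"
  shows "(\<lambda>x. seq_act (f x) (g x)) \<in> M \<rightarrow>\<^sub>M seqZ borel"
  unfolding seq_act_def
  by (rule measurable_seqZI, rule measurable_group_diff[OF measurable_seqZ_nth[OF assms(2)] assms(1)])

lemma (in greg) seq_act_measN [measurable (raw)]:
  fixes f :: "'a \<Rightarrow> 'g"
  assumes "f \<in> M \<rightarrow>\<^sub>M borel" "g \<in> M \<rightarrow>\<^sub>M seqN borel"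
  shows "(\<lambda>x. seq_act (f x) (g x)) \<in> M \<rightarrow>\<^sub>M seqN borel"
  unfolding seq_act_def
  by (rule measurable_seqNI, rule measurable_group_diff[OF measurable_seqN_nth[OF assms(2)] assms(1)])

section \<open>Approximation by functions of the future\<close>

locale greg_extension = greg m m1 T Ti w + gspace_metric_extension W aW V aV q d
  for m :: "'x measure" and m1 :: "'g::{group_add,second_countable_topology} measure"
    and T Ti w and W :: "'w measure" and aW :: "'g \<Rightarrow> 'w \<Rightarrow> 'w" and V :: "'v measure" and aV q d
begin

text \<open>Whether the section of \<open>u\<close> is near is an event of the whole trajectory; up
  to \<open>\<delta> / 2\<close> it is an event \<open>B\<close> seen from some
  \<open>(Ti ^^ n') x\<close>. The new function uses this section on \<open>B\<close> and the
  earlier function elsewhere. Off the two error sets, either \<open>B\<close> holds and the section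
  is near, or it is not near and one of the earlier ones must be.\<close>

lemma approx_near_union:
  assumes \<Phi> [measurable]: "\<Phi> \<in> seqZ borel \<rightarrow>\<^sub>M W" and Q [measurable]: "Q \<in> seqN borel \<Otimes>\<^sub>M borel \<rightarrow>\<^sub>M W"
    and "\<delta> > (0::real)"
  shows "\<exists>n. \<exists>\<Psi>\<in>seqN borel \<rightarrow>\<^sub>M W.
    m.prob {x \<in> space m. (\<exists>u\<in>set us. near e (\<Phi> (traj x)) (Q (fut x, u))) \<and>
      \<not> near e (\<Phi> (traj x)) (\<Psi> (fut ((Ti ^^ n) x)))} < \<delta>"
  using \<open>\<delta> > 0\<close>
proof (induction us arbitrary: \<delta>)
  case Nil
  have "\<Phi> (\<lambda>_. 0) \<in> space W" using measurable_space[OF \<Phi>] by simp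
  then have "(\<lambda>_. \<Phi> (\<lambda>_. 0)) \<in> seqN borel \<rightarrow>\<^sub>M W" by simp
  then show ?case using Nil by (intro exI[of _ 0] bexI[of _ "\<lambda>_. \<Phi> (\<lambda>_. 0)"]) auto
next
  case (Cons u us)
  obtain n \<Psi> where \<Psi> [measurable]: "\<Psi> \<in> seqN borel \<rightarrow>\<^sub>M W"
    and n: "m.prob {x \<in> space m. (\<exists>u\<in>set us. near e (\<Phi> (traj x)) (Q (fut x, u))) \<and>
      \<not> near e (\<Phi> (traj x)) (\<Psi> (fut ((Ti ^^ n) x)))} < \<delta> / 2" (is "m.prob ?E1 < _")
    using Cons.IH[OF half_gt_zero[OF \<open>\<delta> > 0\<close>]] by blast
  let ?D = "{\<gamma> \<in> space (seqZ borel). near e (\<Phi> \<gamma>) (Q (restr_future \<gamma>, u))}"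
  have "?D \<in> sets (seqZ borel)" by measurable
  then obtain n' B where B [measurable]: "B \<in> sets (seqN borel)"
    and n': "m.prob {x \<in> space m. (traj x \<in> ?D) \<noteq> (fut ((Ti ^^ n') x) \<in> B)} < \<delta> / 2" (is "m.prob ?E2 < _")
    using approx_by_past[OF _ half_gt_zero[OF \<open>\<delta> > 0\<close>]] by blast
  define N where "N = n + n'"
  \<comment> \<open>For \<open>y = fut ((Ti ^^ N) x)\<close>, rebasing by \<open>n\<close> gives the
    future seen from \<open>(Ti ^^ n') x\<close> and vice versa, which is why the two indices appear
    exchanged; rebasing by \<open>N\<close> gives \<open>fut x\<close>.\<close>
  define \<Psi>' where "\<Psi>' y = (if rebase n y \<in> B then Q (rebase N y, u) else \<Psi> (rebase n' y))" for y
  have \<Psi>'_meas [measurable]: "\<Psi>' \<in> seqN borel \<rightarrow>\<^sub>M W"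
    unfolding \<Psi>'_def by measurable
  have fut_Tin_meas [measurable]: "(\<lambda>x. fut ((Ti ^^ k) x)) \<in> m \<rightarrow>\<^sub>M seqN borel" for k
    by (rule measurable_compose[OF Tin_meas fut_meas])
  have eq: "\<Psi>' (fut ((Ti ^^ N) x)) = (if fut ((Ti ^^ n') x) \<in> B then Q (fut x, u) else \<Psi> (fut ((Ti ^^ n) x)))"
    if x: "x \<in> space m" for x
    using fut_Tin[OF x, of 0 N] fut_Tin[OF x, of n n'] fut_Tin[OF x, of n' n]
    by (simp add: \<Psi>'_def N_def add.commute)
  have E1: "?E1 \<in> m.events" by measurable
  have E2: "?E2 \<in> m.events" by measurable
  have "m.prob {x \<in> space m. (\<exists>v\<in>set (u # us). near e (\<Phi> (traj x)) (Q (fut x, v))) \<and>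
      \<not> near e (\<Phi> (traj x)) (\<Psi>' (fut ((Ti ^^ N) x)))} \<le> m.prob (?E1 \<union> ?E2)"
  proof (rule m.finite_measure_mono)
    show "{x \<in> space m. (\<exists>v\<in>set (u # us). near e (\<Phi> (traj x)) (Q (fut x, v))) \<and>
      \<not> near e (\<Phi> (traj x)) (\<Psi>' (fut ((Ti ^^ N) x)))} \<subseteq> ?E1 \<union> ?E2"
      by (auto simp: eq fut_def[symmetric] split: if_splits)
    show "?E1 \<union> ?E2 \<in> m.events" using E1 E2 by (rule sets.Un)
  qed
  also have "\<dots> \<le> m.prob ?E1 + m.prob ?E2"
    using E1 E2 by (rule measure_Un_le)
  also have "\<dots> < \<delta>" using n n' by simp
  finally show ?case using \<Psi>'_meas by blast
qed

text \<open>Half of \<open>\<delta>\<close> pays for the points missed by the finite family of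
  sections, half for deciding which section is near. The move by \<open>T ^^ n\<close> costs
  nothing, as it preserves \<open>m\<close> and the group acts isometrically between fibres.\<close>

lemma approx_by_future:
  assumes \<Phi> [measurable]: "\<Phi> \<in> seqZ borel \<rightarrow>\<^sub>M W" and Q [measurable]: "Q \<in> seqN borel \<Otimes>\<^sub>M borel \<rightarrow>\<^sub>M W"
    and law: "distr m (seqN borel \<Otimes>\<^sub>M W) (\<lambda>x. (fut x, \<Phi> (traj x))) =
      distr (m \<Otimes>\<^sub>M unit_uniform) (seqN borel \<Otimes>\<^sub>M W) (\<lambda>p. (fut (fst p), Q (fut (fst p), snd p)))"
    and g [measurable]: "g \<in> seqN borel \<rightarrow>\<^sub>M V" and qg: "AE x in m. q (\<Phi> (traj x)) = g (fut x)"
    and equi: "AE x in m. \<Phi> (traj (T x)) = aW (w x) (\<Phi> (traj x))"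
    and "e > 0" "\<delta> > (0::real)"
  shows "\<exists>\<Psi>\<in>seqN borel \<rightarrow>\<^sub>M W. m.prob {x \<in> space m. \<not> near e (\<Phi> (traj x)) (\<Psi> (fut x))} < \<delta>"
proof -
  have \<Phi>W: "\<Phi> \<gamma> \<in> space W" for \<gamma>
    using measurable_space[OF \<Phi>] by simp
  have \<Phi>t: "(\<lambda>x. \<Phi> (traj x)) \<in> m \<rightarrow>\<^sub>M W" by measurable
  have pos: "AE x in m. emeasure unit_uniform {u. near e (\<Phi> (traj x)) (Q (fut x, u))} \<noteq> 0"
    by (rule randomized_points_near[where Z=fut and \<Phi>="\<lambda>x. \<Phi> (traj x)" and Q=Q and g=g and M=m, OF m.prob_space_axioms fut_meas \<Phi>t Q law g qg \<open>e > 0\<close>])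
  have "Measurable.pred (m \<Otimes>\<^sub>M unit_uniform) (\<lambda>p. near e (\<Phi> (traj (fst p))) (Q (fut (fst p), snd p)))"
    by measurable
  from m.finite_cover_of_positive_slices[OF this pos, of "\<delta> / 2"] \<open>\<delta> > 0\<close>
  obtain us where us: "m.prob {x \<in> space m. \<forall>u\<in>set us. \<not> near e (\<Phi> (traj x)) (Q (fut x, u))} < \<delta> / 2"
      (is "m.prob ?E1 < _")
    by auto
  obtain n \<Psi> where \<Psi> [measurable]: "\<Psi> \<in> seqN borel \<rightarrow>\<^sub>M W"
    and n: "m.prob {x \<in> space m. (\<exists>u\<in>set us. near e (\<Phi> (traj x)) (Q (fut x, u))) \<and>
      \<not> near e (\<Phi> (traj x)) (\<Psi> (fut ((Ti ^^ n) x)))} < \<delta> / 2" (is "m.prob ?E2 < _")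
    using approx_near_union[OF \<Phi> Q half_gt_zero[OF \<open>\<delta> > 0\<close>], of us e] by blast
  have \<Psi>W: "\<Psi> y \<in> space W" for y
    using measurable_space[OF \<Psi>] by simp
  have fut_Tin_meas [measurable]: "(\<lambda>x. fut ((Ti ^^ k) x)) \<in> m \<rightarrow>\<^sub>M seqN borel" for k
    by (rule measurable_compose[OF Tin_meas fut_meas])
  have traj_Tn_meas [measurable]: "(\<lambda>x. traj ((T ^^ k) x)) \<in> m \<rightarrow>\<^sub>M seqZ borel" for k
    by (rule measurable_compose[OF Tn_meas traj_meas])
  let ?B = "{x \<in> space m. \<not> near e (\<Phi> (traj x)) (\<Psi> (fut ((Ti ^^ n) x)))}"
  have E1: "?E1 \<in> m.events" by measurable
  have E2: "?E2 \<in> m.events" by measurable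
  have B: "?B \<in> m.events" by measurable
  have "m.prob ?B \<le> m.prob (?E1 \<union> ?E2)"
    by (rule m.finite_measure_mono) (use E1 E2 in auto)
  also have "\<dots> \<le> m.prob ?E1 + m.prob ?E2"
    using E1 E2 by (rule measure_Un_le)
  also have "\<dots> < \<delta>" using us n by simp
  finally have less: "m.prob ?B < \<delta>" .
  have iter: "AE x in m. \<Phi> (traj ((T ^^ k) x)) = aW (fut x k) (\<Phi> (traj x))" for k
  proof (induction k)
    case 0
    show ?case by (simp add: fut_def restr_future_def traj_0 aW_0[OF \<Phi>W])
  next
    case (Suc k)
    show ?case
      using Suc AE_Tn[OF equi, of k] AE_space
    proof eventually_elim
      case (elim x)
      have "w ((T ^^ k) x) + fut x k = fut x (Suc k)"
        using traj_1[OF Tn_space[OF elim(3)], of k] traj_Tn[OF elim(3), of k 1]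
        by (simp add: fut_def restr_future_def diff_eq_eq)
      then show ?case
        using elim(1,2) by (simp add: aW_add[OF \<Phi>W, symmetric])
    qed
  qed
  \<comment> \<open>At \<open>y = fut x\<close> the entry \<open>y n\<close> is the cocycle value by
    which \<open>iter\<close> relates \<open>\<Phi>\<close> at \<open>(T ^^ n) x\<close> and at
    \<open>x\<close>.\<close>
  define \<Psi>' where "\<Psi>' y = aW (- y n) (\<Psi> y)" for y
  have nth: "(\<lambda>y::nat \<Rightarrow> 'g. y n) \<in> seqN borel \<rightarrow>\<^sub>M borel"
    by (rule measurable_seqN_nth) simp
  have \<Psi>'_meas [measurable]: "\<Psi>' \<in> seqN borel \<rightarrow>\<^sub>M W"
    unfolding \<Psi>'_def by (intro aW_measI measurable_group_uminus nth \<Psi>)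
  have "m.prob {x \<in> space m. \<not> near e (\<Phi> (traj x)) (\<Psi>' (fut x))}
      = m.prob {x \<in> space m. \<not> near e (\<Phi> (traj ((T ^^ n) x))) (\<Psi> (fut x))}"
  proof (rule measure_eq_AE)
    show "AE x in m. (x \<in> {x \<in> space m. \<not> near e (\<Phi> (traj x)) (\<Psi>' (fut x))}) =
        (x \<in> {x \<in> space m. \<not> near e (\<Phi> (traj ((T ^^ n) x))) (\<Psi> (fut x))})"
      using iter[of n]
    proof eventually_elim
      case (elim x)
      have "near e (aW (fut x n) (\<Phi> (traj x))) (\<Psi> (fut x))
          \<longleftrightarrow> near e (aW (fut x n) (\<Phi> (traj x))) (aW (fut x n) (\<Psi>' (fut x)))"
        by (simp add: \<Psi>'_def aW_cancel_uminus[OF \<Psi>W])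
      also have "\<dots> \<longleftrightarrow> near e (\<Phi> (traj x)) (\<Psi>' (fut x))"
        by (rule near_aW_iff[OF \<Phi>W]) (simp add: \<Psi>'_def aW_space[OF \<Psi>W])
      finally show ?case using elim by simp
    qed
  qed measurable
  \<comment> \<open>At \<open>(T ^^ n) x\<close> the argument \<open>fut ((Ti ^^ n) _)\<close> of
    \<open>\<Psi>\<close> becomes \<open>fut x\<close>, so the error set is a preimage of
    \<open>?B\<close>.\<close>
  also have "{x \<in> space m. \<not> near e (\<Phi> (traj ((T ^^ n) x))) (\<Psi> (fut x))} = (T ^^ n) -` ?B \<inter> space m"
    using Tn_space Tin_Tn by auto
  also have "m.prob ((T ^^ n) -` ?B \<inter> space m) = measure (distr m m (T ^^ n)) ?B"
    by (rule measure_distr[OF Tn_meas B, symmetric])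
  also have "\<dots> < \<delta>" using less by (simp add: Tn_mp)
  finally show ?thesis using \<Psi>'_meas by blast
qed

end

section \<open>Almost everywhere statements for the sequence measure\<close>

context greg
begin

lemma mtilde_eq:
  "mtilde m m1 T Ti w = distr (m \<Otimes>\<^sub>M m1) (seqZ borel) (\<lambda>p. seq_act (snd p) (traj (fst p)))"
  unfolding mtilde_def by (rule distr_cong) (auto simp: seq_act_def traj_def)

lemma sets_mtilde: "sets (mtilde m m1 T Ti w) = sets (seqZ borel)"
  and space_mtilde: "space (mtilde m m1 T Ti w) = UNIV"
  by (simp_all add: mtilde_def)

lemma AE_mtildeD:
  assumes "AE \<gamma> in mtilde m m1 T Ti w. P \<gamma>"
  shows "AE x in m. AE h in m1. P (seq_act h (traj x))"
proof -
  interpret P: pair_prob_space m m1 ..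
  have "AE p in m \<Otimes>\<^sub>M m1. P (seq_act (snd p) (traj (fst p)))"
    using assms unfolding mtilde_eq by (rule AE_distrD[rotated]) measurable
  from P.AE_pair[OF this] show ?thesis by simp
qed

lemma AE_mtildeI:
  assumes P [measurable]: "Measurable.pred (seqZ borel) P"
    and AE: "AE x in m. AE h in m1. P (seq_act h (traj x))"
  shows "AE \<gamma> in mtilde m m1 T Ti w. P \<gamma>"
proof -
  interpret P: pair_prob_space m m1 ..
  have "AE p in m \<Otimes>\<^sub>M m1. P (seq_act (snd p) (traj (fst p)))"
  proof (rule P.AE_pair_measure)
    show "{p \<in> space (m \<Otimes>\<^sub>M m1). P (seq_act (snd p) (traj (fst p)))} \<in> sets (m \<Otimes>\<^sub>M m1)" by measurable
  qed (use AE in simp)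
  then show ?thesis unfolding mtilde_eq
    by (subst AE_distr_iff) measurable
qed

text \<open>Shifting the sequence of \<open>(x, h)\<close> gives the sequence of
  \<open>(T x, h - w x)\<close>. The first move preserves \<open>m\<close>, the second preserves
  null sets of \<open>m1\<close>.\<close>

lemma AE_mtilde_shiftZ:
  assumes P: "Measurable.pred (seqZ borel) P" and AE: "AE \<gamma> in mtilde m m1 T Ti w. P \<gamma>"
  shows "AE \<gamma> in mtilde m m1 T Ti w. P (shiftZ \<gamma>)"
proof (rule AE_mtildeI)
  show "Measurable.pred (seqZ borel) (\<lambda>\<gamma>. P (shiftZ \<gamma>))"
    by (rule measurable_compose[OF shiftZ_meas P])
  have "AE x in m. AE h in m1. P (seq_act h (traj (T x)))"
    using AE_Tn[OF AE_mtildeD[OF AE], of 1] by simp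
  then show "AE x in m. AE h in m1. P (shiftZ (seq_act h (traj x)))"
    using AE_space
  proof eventually_elim
    case (elim x)
    have "shiftZ (seq_act h (traj x)) = seq_act (h + - w x) (traj (T x))" for h
      by (simp add: traj_T_eq[OF elim(2)] seq_act_seq_act seq_act_shiftZ add.assoc)
    then show ?case using AE_right_translate[OF elim(1), of "- w x"] by simp
  qed
qed

lemma AE_mtilde_seq_act:
  assumes P [measurable]: "Measurable.pred (seqZ borel) P" and AE: "AE \<gamma> in mtilde m m1 T Ti w. P \<gamma>"
  shows "AE \<gamma> in mtilde m m1 T Ti w. P (seq_act g \<gamma>)"
proof (rule AE_mtildeI)
  show "Measurable.pred (seqZ borel) (\<lambda>\<gamma>. P (seq_act g \<gamma>))" by measurable
  show "AE x in m. AE h in m1. P (seq_act g (seq_act h (traj x)))"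
    using AE_mtildeD[OF AE]
  proof eventually_elim
    case (elim x)
    then show ?case using AE_left_translate[OF elim, of g] by (simp add: seq_act_seq_act)
  qed
qed

end

text \<open>Trajectories with entry 0 at the origin may form a null set, so \<open>F\<close> cannot
  be evaluated there. Fubini turns equivariance for each \<open>g\<close> into a statement for
  almost all \<open>h0\<close>, \<open>x\<close> and \<open>g\<close> in this order; with a good
  \<open>h0\<close> fixed, \<open>\<Phi>\<close> translates by \<open>h0\<close>, applies
  \<open>F\<close> and translates back. The relation to \<open>f\<close> is carried along at the
  same \<open>h0\<close>.\<close>

lemma (in greg_extension) equivariant_section:
  assumes F [measurable]: "F \<in> seqZ borel \<rightarrow>\<^sub>M W"
    and equi: "\<And>g. AE \<gamma> in mtilde m m1 T Ti w. F (seq_act g \<gamma>) = aW g (F \<gamma>)"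
    and f [measurable]: "f \<in> seqN borel \<rightarrow>\<^sub>M V"
    and qf: "AE \<gamma> in mtilde m m1 T Ti w. q (F \<gamma>) = f (restr_future \<gamma>)"
  obtains \<Phi> g where "\<Phi> \<in> seqZ borel \<rightarrow>\<^sub>M W" "g \<in> seqN borel \<rightarrow>\<^sub>M V"
    "AE x in m. AE h in m1. F (seq_act h (traj x)) = aW h (\<Phi> (traj x))"
    "AE x in m. q (\<Phi> (traj x)) = g (fut x)"
proof -
  interpret P: pair_prob_space m m1 ..
  interpret P': pair_prob_space m1 m ..
  interpret R: pair_prob_space m1 "m1 \<Otimes>\<^sub>M m" ..
  have FW: "F \<gamma> \<in> space W" for \<gamma> using measurable_space[OF F] by simp
  have "AE g in m1. AE p in m1 \<Otimes>\<^sub>M m. F (seq_act (g + fst p) (traj (snd p))) = aW g (F (seq_act (fst p) (traj (snd p))))"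
  proof (rule AE_I2)
    fix g
    have "AE x in m. AE h in m1. F (seq_act (g + h) (traj x)) = aW g (F (seq_act h (traj x)))"
      using AE_mtildeD[OF equi[of g]] by (simp add: seq_act_seq_act)
    moreover have "Measurable.pred (m \<Otimes>\<^sub>M m1) (\<lambda>p. F (seq_act (g + snd p) (traj (fst p))) = aW g (F (seq_act (snd p) (traj (fst p)))))"
      by (rule standard_borel_eq_measurable[OF W_std]) measurable
    ultimately have "AE h in m1. AE x in m. F (seq_act (g + h) (traj x)) = aW g (F (seq_act h (traj x)))"
      by (subst (asm) P.AE_commute) (simp_all add: pred_def)
    moreover have "Measurable.pred (m1 \<Otimes>\<^sub>M m) (\<lambda>p. F (seq_act (g + fst p) (traj (snd p))) = aW g (F (seq_act (fst p) (traj (snd p)))))"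
      by (rule standard_borel_eq_measurable[OF W_std]) measurable
    ultimately show "AE p in m1 \<Otimes>\<^sub>M m. F (seq_act (g + fst p) (traj (snd p))) = aW g (F (seq_act (fst p) (traj (snd p))))"
      by (intro P'.AE_pair_measure) (simp_all add: pred_def)
  qed
  moreover have "Measurable.pred (m1 \<Otimes>\<^sub>M (m1 \<Otimes>\<^sub>M m))
      (\<lambda>z. F (seq_act (fst z + fst (snd z)) (traj (snd (snd z)))) = aW (fst z) (F (seq_act (fst (snd z)) (traj (snd (snd z))))))"
    by (rule standard_borel_eq_measurable[OF W_std]) measurable
  ultimately have "AE p in m1 \<Otimes>\<^sub>M m. AE g in m1. F (seq_act (g + fst p) (traj (snd p))) = aW g (F (seq_act (fst p) (traj (snd p))))"
    by (subst (asm) R.AE_commute) (simp_all add: pred_def)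
  from P'.AE_pair[OF this]
  have 1: "AE h in m1. AE x in m. AE g in m1. F (seq_act (g + h) (traj x)) = aW g (F (seq_act h (traj x)))"
    by simp
  have "Measurable.pred (m \<Otimes>\<^sub>M m1) (\<lambda>p. q (F (seq_act (snd p) (traj (fst p)))) = f (restr_future (seq_act (snd p) (traj (fst p)))))"
    by (rule standard_borel_eq_measurable[OF V_std]) measurable
  then have 2: "AE h in m1. AE x in m. q (F (seq_act h (traj x))) = f (restr_future (seq_act h (traj x)))"
    using AE_mtildeD[OF qf] by (subst (asm) P.AE_commute) (simp_all add: pred_def)
  have "AE h in m1. (AE x in m. AE g in m1. F (seq_act (g + h) (traj x)) = aW g (F (seq_act h (traj x)))) \<and>
      (AE x in m. q (F (seq_act h (traj x))) = f (restr_future (seq_act h (traj x))))"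
    using 1 2 by eventually_elim simp
  then obtain h0 where h1: "AE x in m. AE g in m1. F (seq_act (g + h0) (traj x)) = aW g (F (seq_act h0 (traj x)))"
    and h2: "AE x in m. q (F (seq_act h0 (traj x))) = f (restr_future (seq_act h0 (traj x)))"
    using eventually_happens'[OF ae_filter_bot] by blast
  show ?thesis
  proof (rule that)
    show "(\<lambda>\<gamma>. aW (- h0) (F (seq_act h0 \<gamma>))) \<in> seqZ borel \<rightarrow>\<^sub>M W" by measurable
    show "(\<lambda>y. aV (- h0) (f (seq_act h0 y))) \<in> seqN borel \<rightarrow>\<^sub>M V" by measurable
    show "AE x in m. AE h in m1. F (seq_act h (traj x)) = aW h (aW (- h0) (F (seq_act h0 (traj x))))"
      using h1
    proof eventually_elim
      case (elim x)
      show ?case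
        using AE_right_translate[OF elim, of "- h0"]
        by eventually_elim (simp add: aW_add[OF FW, symmetric])
    qed
    show "AE x in m. q (aW (- h0) (F (seq_act h0 (traj x)))) = aV (- h0) (f (seq_act h0 (fut x)))"
      using h2 by eventually_elim (simp add: q_aW[OF FW] fut_def seq_act_restr_future)
  qed
qed

lemma (in greg_extension) future_factor:
  assumes F [measurable]: "F \<in> seqZ borel \<rightarrow>\<^sub>M W" and F_shift: "\<And>\<gamma>. F (shiftZ \<gamma>) = F \<gamma>"
    and equi: "\<And>g. AE \<gamma> in mtilde m m1 T Ti w. F (seq_act g \<gamma>) = aW g (F \<gamma>)"
    and f: "f \<in> seqN borel \<rightarrow>\<^sub>M V"
    and qf: "AE \<gamma> in mtilde m m1 T Ti w. q (F \<gamma>) = f (restr_future \<gamma>)"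
  shows "\<exists>\<phi>\<in>seqN borel \<rightarrow>\<^sub>M W. (\<forall>y. \<phi> (shiftN y) = \<phi> y) \<and>
    (\<forall>g. AE \<gamma> in mtilde m m1 T Ti w. \<phi> (seq_act g (restr_future \<gamma>)) = aW g (\<phi> (restr_future \<gamma>))) \<and>
    (AE \<gamma> in mtilde m m1 T Ti w. F \<gamma> = \<phi> (restr_future \<gamma>))"
proof -
  obtain \<Phi> g where \<Phi> [measurable]: "\<Phi> \<in> seqZ borel \<rightarrow>\<^sub>M W" and g: "g \<in> seqN borel \<rightarrow>\<^sub>M V"
    and F\<Phi>: "AE x in m. AE h in m1. F (seq_act h (traj x)) = aW h (\<Phi> (traj x))"
    and qg: "AE x in m. q (\<Phi> (traj x)) = g (fut x)"
    using equivariant_section[OF F equi f qf] by blast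
  have FW: "F \<gamma> \<in> space W" and \<Phi>W: "\<Phi> \<gamma> \<in> space W" for \<gamma>
    using measurable_space[OF F] measurable_space[OF \<Phi>] by auto
  \<comment> \<open>Up to a shift, which \<open>F\<close> does not see, the sequence of
    \<open>(T x, h)\<close> is that of \<open>(x, h + w x)\<close>. Comparing the two values of
    \<open>F\<close> at one generic \<open>h\<close> and cancelling \<open>h\<close> gives the
    relation.\<close>
  have \<Phi>T: "AE x in m. \<Phi> (traj (T x)) = aW (w x) (\<Phi> (traj x))"
    using F\<Phi> AE_Tn[OF F\<Phi>, of 1] AE_space
  proof eventually_elim
    case (elim x)
    have "AE h in m1. F (seq_act (h + w x) (traj x)) = aW (h + w x) (\<Phi> (traj x))"
      by (rule AE_right_translate[OF elim(1)])
    then have "AE h in m1. aW h (\<Phi> (traj (T x))) = aW h (aW (w x) (\<Phi> (traj x)))"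
      using elim(2)
    proof eventually_elim
      case (elim h)
      have "F (seq_act h (traj (T x))) = F (seq_act (h + w x) (traj x))"
        using \<open>x \<in> space m\<close> by (simp add: traj_T_eq seq_act_shiftZ F_shift seq_act_seq_act)
      then show ?case using elim by (simp add: aW_add[OF \<Phi>W])
    qed
    then obtain h where "aW h (\<Phi> (traj (T x))) = aW h (aW (w x) (\<Phi> (traj x)))"
      using eventually_happens'[OF ae_filter_bot] by blast
    then show ?case by (rule aW_inj[OF \<Phi>W aW_space[OF \<Phi>W]])
  qed
  have \<Phi>t: "(\<lambda>x. \<Phi> (traj x)) \<in> m \<rightarrow>\<^sub>M W" by measurable
  obtain Q where Q: "Q \<in> seqN borel \<Otimes>\<^sub>M borel \<rightarrow>\<^sub>M W"
    and law: "distr m (seqN borel \<Otimes>\<^sub>M W) (\<lambda>x. (fut x, \<Phi> (traj x))) =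
      distr (m \<Otimes>\<^sub>M unit_uniform) (seqN borel \<Otimes>\<^sub>M W) (\<lambda>p. (fut (fst p), Q (fut (fst p), snd p)))"
    using m.randomization[OF W_std fut_meas \<Phi>t] by blast
  obtain \<phi>0 where \<phi>0 [measurable]: "\<phi>0 \<in> seqN borel \<rightarrow>\<^sub>M W" and \<Phi>_eq: "AE x in m. \<Phi> (traj x) = \<phi>0 (fut x)"
    using factor_of_approximations[OF m.prob_space_axioms fut_meas \<Phi>t Q law
        approx_by_future[OF \<Phi> Q law g qg \<Phi>T]] by blast
  \<comment> \<open>The entry 0 of \<open>seq_act h (traj x)\<close> is \<open>- h\<close>. The
    future therefore reveals \<open>h\<close>, and translating back recovers
    \<open>fut x\<close>.\<close>
  define \<phi>1 where "\<phi>1 y = aW (- y 0) (\<phi>0 (seq_act (y 0) y))" for y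
  have y0 [measurable]: "(\<lambda>y::nat \<Rightarrow> 'g. y 0) \<in> seqN borel \<rightarrow>\<^sub>M borel"
    by (rule measurable_seqN_nth) simp
  have \<phi>1 [measurable]: "\<phi>1 \<in> seqN borel \<rightarrow>\<^sub>M W"
    unfolding \<phi>1_def by measurable
  have pred1: "Measurable.pred (seqZ borel) (\<lambda>\<gamma>. F \<gamma> = \<phi>1 (restr_future \<gamma>))"
    by (rule standard_borel_eq_measurable[OF W_std]) measurable
  have AE1: "AE \<gamma> in mtilde m m1 T Ti w. F \<gamma> = \<phi>1 (restr_future \<gamma>)"
  proof (rule AE_mtildeI[OF pred1])
    show "AE x in m. AE h in m1. F (seq_act h (traj x)) = \<phi>1 (restr_future (seq_act h (traj x)))"
      using F\<Phi> \<Phi>_eq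
    proof eventually_elim
      case (elim x)
      have "\<phi>1 (restr_future (seq_act h (traj x))) = aW h (\<Phi> (traj x))" for h
      proof -
        have "restr_future (seq_act h (traj x)) 0 = - h"
          by (simp add: restr_future_def seq_act_def traj_0)
        then show ?thesis
          by (simp add: \<phi>1_def seq_act_restr_future seq_act_seq_act elim(2) fut_def)
      qed
      then show ?case using elim(1) by simp
    qed
  qed
  \<comment> \<open>Together these make \<open>\<phi>1\<close> constant along almost every shift
    orbit, where its strictly invariant version agrees with it.\<close>
  have shift_k: "AE \<gamma> in mtilde m m1 T Ti w. F \<gamma> = \<phi>1 ((shiftN ^^ k) (restr_future \<gamma>))" for k
  proof (induction k)
    case (Suc k)
    have "Measurable.pred (seqZ borel) (\<lambda>\<gamma>. F \<gamma> = \<phi>1 ((shiftN ^^ k) (restr_future \<gamma>)))"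
      by (intro standard_borel_eq_measurable[OF W_std] F measurable_compose[OF _ \<phi>1]
          measurable_compose[OF restr_future_meas measurable_funpow[OF shiftN_meas]])
    from AE_mtilde_shiftZ[OF this Suc] show ?case
      by eventually_elim (simp add: F_shift shiftN_restr_future[symmetric] funpow_swap1)
  qed (use AE1 in simp)
  obtain \<phi> where \<phi> [measurable]: "\<phi> \<in> seqN borel \<rightarrow>\<^sub>M W" and \<phi>_shift: "\<And>y. \<phi> (shiftN y) = \<phi> y"
    and \<phi>_eq: "\<And>y. (\<And>k. \<phi>1 ((shiftN ^^ k) y) = \<phi>1 y) \<Longrightarrow> \<phi> y = \<phi>1 y"
    using shiftN_invariant_version[OF W_std \<phi>1] by blast
  have "AE \<gamma> in mtilde m m1 T Ti w. \<forall>k. F \<gamma> = \<phi>1 ((shiftN ^^ k) (restr_future \<gamma>))"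
    using shift_k by (subst AE_all_countable) blast
  then have F\<phi>: "AE \<gamma> in mtilde m m1 T Ti w. F \<gamma> = \<phi> (restr_future \<gamma>)"
  proof eventually_elim
    case (elim \<gamma>)
    have "F \<gamma> = \<phi>1 (restr_future \<gamma>)" using elim[rule_format, of 0] by simp
    moreover have "\<phi> (restr_future \<gamma>) = \<phi>1 (restr_future \<gamma>)"
      by (rule \<phi>_eq) (metis elim \<open>F \<gamma> = \<phi>1 (restr_future \<gamma>)\<close>)
    ultimately show ?case by simp
  qed
  have pred: "Measurable.pred (seqZ borel) (\<lambda>\<gamma>. F \<gamma> = \<phi> (restr_future \<gamma>))"
    by (rule standard_borel_eq_measurable[OF W_std]) measurable
  have "AE \<gamma> in mtilde m m1 T Ti w. \<phi> (seq_act g (restr_future \<gamma>)) = aW g (\<phi> (restr_future \<gamma>))" for g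
    using equi[of g] F\<phi> AE_mtilde_seq_act[OF pred F\<phi>, of g]
    by eventually_elim (simp add: seq_act_restr_future)
  with \<phi> \<phi>_shift F\<phi> show ?thesis by blast
qed

section \<open>Ergodic components\<close>

lemma sigma_algebra_invariant_sets:
  assumes sp: "space M = UNIV"
  shows "sigma_algebra UNIV (invariant_sets M S)"
proof -
  have "{} \<in> sets M" "\<And>a. a \<in> sets M \<Longrightarrow> UNIV - a \<in> sets M"
    using sets.compl_sets[of _ M] sp by auto
  then show ?thesis
    unfolding sigma_algebra_iff2 invariant_sets_def sp by (auto, blast+)
qed

lemma space_ergodic_components: "space M = UNIV \<Longrightarrow> space (ergodic_components M S) = UNIV"
  unfolding ergodic_components_def by (subst space_measure_of) (auto simp: invariant_sets_def)

lemma sets_ergodic_components: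
  "space M = UNIV \<Longrightarrow> sets (ergodic_components M S) = invariant_sets M S"
  unfolding ergodic_components_def
  using sigma_algebra.sets_measure_of_eq[OF sigma_algebra_invariant_sets] by metis

lemma emeasure_ergodic_components:
  assumes sp: "space M = UNIV" and A: "A \<in> invariant_sets M S"
  shows "emeasure (ergodic_components M S) A = emeasure M A"
  unfolding ergodic_components_def sp
proof (rule emeasure_measure_of_sigma[OF sigma_algebra_invariant_sets[OF sp] _ _ A])
  show "positive (invariant_sets M S) (emeasure M)" by (simp add: positive_def)
  show "countably_additive (invariant_sets M S) (emeasure M)"
  proof (rule countably_additiveI)
    fix B :: "nat \<Rightarrow> _" assume "range B \<subseteq> invariant_sets M S" "disjoint_family B"
    then show "(\<Sum>i. emeasure M (B i)) = emeasure M (\<Union>i. B i)"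
      by (intro suminf_emeasure) (auto simp: invariant_sets_def)
  qed
qed

lemma AE_ergodic_componentsD:
  assumes sp: "space M = UNIV" and "AE x in ergodic_components M S. P x"
  shows "AE x in M. P x"
proof -
  obtain N where N: "{x \<in> space (ergodic_components M S). \<not> P x} \<subseteq> N"
      "emeasure (ergodic_components M S) N = 0" "N \<in> sets (ergodic_components M S)"
    using assms(2) by (rule AE_E)
  then have "N \<in> invariant_sets M S" by (simp add: sets_ergodic_components[OF sp])
  with N have "N \<in> null_sets M"
    by (auto simp: emeasure_ergodic_components[OF sp] invariant_sets_def null_sets_def)
  then show ?thesis
    using N(1) by (intro AE_I') (auto simp: space_ergodic_components[OF sp])
qed

text \<open>An exceptional set counts in the factor only if it is invariant, hence the strict
  invariance demanded of \<open>P\<close>.\<close>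

lemma AE_ergodic_componentsI:
  assumes sp: "space M = UNIV" and P: "Measurable.pred M P" and inv: "\<And>x. P (S x) = P x"
    and AE: "AE x in M. P x"
  shows "AE x in ergodic_components M S. P x"
proof -
  have "{x. \<not> P x} \<in> sets M" using P sp by (simp add: pred_def) (metis Compl_eq_Diff_UNIV Collect_neg_eq sets.compl_sets)
  then have N: "{x. \<not> P x} \<in> invariant_sets M S" by (auto simp: invariant_sets_def inv sp)
  moreover have "emeasure M {x. \<not> P x} = 0"
    using AE \<open>{x. \<not> P x} \<in> sets M\<close> by (subst (asm) AE_iff_measurable[of "{x. \<not> P x}"]) (auto simp: sp)
  ultimately have "{x. \<not> P x} \<in> null_sets (ergodic_components M S)"
    by (simp add: null_sets_def emeasure_ergodic_components[OF sp] sets_ergodic_components[OF sp])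
  then show ?thesis by (rule AE_I') auto
qed

lemma measurable_ergodic_componentsI:
  assumes sp: "space M = UNIV" and F: "F \<in> M \<rightarrow>\<^sub>M W" and inv: "\<And>x. F (S x) = F x"
  shows "F \<in> ergodic_components M S \<rightarrow>\<^sub>M W"
proof (rule measurableI)
  show "F x \<in> space W" for x using measurable_space[OF F] sp by simp
  show "F -` A \<inter> space (ergodic_components M S) \<in> sets (ergodic_components M S)" if "A \<in> sets W" for A
    using measurable_sets[OF F that]
    by (auto simp: space_ergodic_components[OF sp] sets_ergodic_components[OF sp] invariant_sets_def sp inv)
qed

lemma measurable_ergodic_componentsD:
  assumes sp: "space M = UNIV" and F: "F \<in> ergodic_components M S \<rightarrow>\<^sub>M W"
  shows "F \<in> M \<rightarrow>\<^sub>M W"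
proof (rule measurableI)
  show "F x \<in> space W" for x using measurable_space[OF F] by (simp add: space_ergodic_components[OF sp])
  show "F -` A \<inter> space M \<in> sets M" if "A \<in> sets W" for A
    using measurable_sets[OF F that]
    by (auto simp: space_ergodic_components[OF sp] sets_ergodic_components[OF sp] invariant_sets_def sp)
qed

text \<open>Points of \<open>W\<close> are measurable, so level sets of \<open>F\<close> are
  strictly invariant and the equation holds at every point.\<close>

lemma ergodic_components_map_invariant:
  assumes sp: "space M = UNIV" and W: "standard_borel W" and F: "F \<in> ergodic_components M S \<rightarrow>\<^sub>M W"
  shows "F (S x) = F x"
proof -
  have "F x \<in> space W" using measurable_space[OF F] by (simp add: space_ergodic_components[OF sp])
  then have "{F x} \<in> sets W" by (rule standard_borel_singleton[OF W])
  from measurable_sets[OF F this] have "F -` {F x} \<in> invariant_sets M S"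
    by (simp add: space_ergodic_components[OF sp] sets_ergodic_components[OF sp])
  then have "S -` (F -` {F x}) = F -` {F x}" by (simp add: invariant_sets_def sp)
  then show ?thesis by blast
qed

text \<open>Maps on the component spaces are the shift-invariant maps on sequences, and
  \<open>r\<close> stands for either restriction. \<open>r_shift\<close> is phrased through
  invariant functions because the two-sided shift acts on futures as \<open>shiftN\<close>, whereas
  on pasts it is undone by \<open>shiftN\<close>.\<close>

lemma (in greg_extension) rel_metric_ergodic_wrtI:
  assumes r [measurable]: "r \<in> seqZ borel \<rightarrow>\<^sub>M seqN borel"
    and r_shift: "\<And>(\<phi> :: _ \<Rightarrow> 'w) \<gamma>. (\<And>y. \<phi> (shiftN y) = \<phi> y) \<Longrightarrow> \<phi> (r (shiftZ \<gamma>)) = \<phi> (r \<gamma>)"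
    and factor: "\<And>F f. F \<in> seqZ borel \<rightarrow>\<^sub>M W \<Longrightarrow> (\<And>\<gamma>. F (shiftZ \<gamma>) = F \<gamma>) \<Longrightarrow>
      (\<And>g. AE \<gamma> in mtilde m m1 T Ti w. F (seq_act g \<gamma>) = aW g (F \<gamma>)) \<Longrightarrow>
      f \<in> seqN borel \<rightarrow>\<^sub>M V \<Longrightarrow> (\<And>y. f (shiftN y) = f y) \<Longrightarrow>
      AE \<gamma> in mtilde m m1 T Ti w. q (F \<gamma>) = f (r \<gamma>) \<Longrightarrow>
      \<exists>\<phi>\<in>seqN borel \<rightarrow>\<^sub>M W. (\<forall>y. \<phi> (shiftN y) = \<phi> y) \<and>
        (\<forall>g. AE \<gamma> in mtilde m m1 T Ti w. \<phi> (seq_act g (r \<gamma>)) = aW g (\<phi> (r \<gamma>))) \<and>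
        (AE \<gamma> in mtilde m m1 T Ti w. F \<gamma> = \<phi> (r \<gamma>))"
  shows "rel_metric_ergodic_wrt (ergodic_components (mtilde m m1 T Ti w) shiftZ) seq_act
    (ergodic_components (distr (mtilde m m1 T Ti w) (seqN borel) r) shiftN) seq_act r W aW V aV q d"
  unfolding rel_metric_ergodic_wrt_def
proof (intro impI allI, elim conjE)
  let ?mt = "mtilde m m1 T Ti w"
  let ?mr = "distr ?mt (seqN borel) r"
  let ?E = "ergodic_components ?mt shiftZ"
  let ?Er = "ergodic_components ?mr shiftN"
  fix F f
  assume F: "gmap ?E seq_act W aW F" and f: "gmap ?Er seq_act V aV f" and qf: "AE \<gamma> in ?E. q (F \<gamma>) = f (r \<gamma>)"
  have sp: "space ?mr = UNIV" by simp
  have sets_mt: "measurable ?mt N = measurable (seqZ borel) N" for N :: "'z measure"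
    by (rule measurable_cong_sets[OF sets_mtilde refl])
  have sets_mr: "measurable ?mr N = measurable (seqN borel) N" for N :: "'z measure"
    by (rule measurable_cong_sets) simp_all
  have F_E: "F \<in> ?E \<rightarrow>\<^sub>M W" and f_E: "f \<in> ?Er \<rightarrow>\<^sub>M V" using F f by (auto simp: gmap_def)
  have F_meas: "F \<in> seqZ borel \<rightarrow>\<^sub>M W"
    using measurable_ergodic_componentsD[OF space_mtilde F_E] by (simp add: sets_mt)
  have f_meas: "f \<in> seqN borel \<rightarrow>\<^sub>M V"
    using measurable_ergodic_componentsD[OF sp f_E] by (simp add: sets_mr)
  have F_shift: "F (shiftZ \<gamma>) = F \<gamma>" for \<gamma>
    by (rule ergodic_components_map_invariant[OF space_mtilde W_std F_E])
  have f_shift: "f (shiftN y) = f y" for y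
    by (rule ergodic_components_map_invariant[OF sp V_std f_E])
  have F_equi: "AE \<gamma> in ?mt. F (seq_act g \<gamma>) = aW g (F \<gamma>)" for g
    using F by (intro AE_ergodic_componentsD[OF space_mtilde]) (auto simp: gmap_def)
  have "\<exists>\<phi>\<in>seqN borel \<rightarrow>\<^sub>M W. (\<forall>y. \<phi> (shiftN y) = \<phi> y) \<and>
        (\<forall>g. AE \<gamma> in ?mt. \<phi> (seq_act g (r \<gamma>)) = aW g (\<phi> (r \<gamma>))) \<and>
        (AE \<gamma> in ?mt. F \<gamma> = \<phi> (r \<gamma>))"
    by (rule factor[OF F_meas F_shift F_equi f_meas f_shift AE_ergodic_componentsD[OF space_mtilde qf]])
  then obtain \<phi> where \<phi> [measurable]: "\<phi> \<in> seqN borel \<rightarrow>\<^sub>M W" and \<phi>_shift: "\<And>y. \<phi> (shiftN y) = \<phi> y"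
    and \<phi>_equi: "\<And>g. AE \<gamma> in ?mt. \<phi> (seq_act g (r \<gamma>)) = aW g (\<phi> (r \<gamma>))"
    and F\<phi>: "AE \<gamma> in ?mt. F \<gamma> = \<phi> (r \<gamma>)"
    by blast
  have "AE y in ?Er. \<phi> (seq_act g y) = aW g (\<phi> y)" for g
  proof (rule AE_ergodic_componentsI[OF sp])
    have pred: "Measurable.pred (seqN borel) (\<lambda>y. \<phi> (seq_act g y) = aW g (\<phi> y))"
      by (rule standard_borel_eq_measurable[OF W_std]) measurable
    then show "Measurable.pred ?mr (\<lambda>y. \<phi> (seq_act g y) = aW g (\<phi> y))" by (simp only: sets_mr)
    show "(\<phi> (seq_act g (shiftN y)) = aW g (\<phi> (shiftN y))) = (\<phi> (seq_act g y) = aW g (\<phi> y))" for y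
      by (simp add: seq_act_shiftN \<phi>_shift)
    have "r \<in> ?mt \<rightarrow>\<^sub>M seqN borel" using r by (simp only: sets_mt)
    then show "AE y in ?mr. \<phi> (seq_act g y) = aW g (\<phi> y)"
      using \<phi>_equi[of g] pred by (subst AE_distr_iff) (simp_all add: pred_def)
  qed
  moreover have "\<phi> \<in> ?Er \<rightarrow>\<^sub>M W"
    by (rule measurable_ergodic_componentsI[OF sp, where S=shiftN]) (use \<phi> \<phi>_shift in \<open>simp_all only: sets_mr\<close>)
  moreover have "AE \<gamma> in ?E. F \<gamma> = \<phi> (r \<gamma>)"
  proof (rule AE_ergodic_componentsI[OF space_mtilde _ _ F\<phi>])
    have "Measurable.pred (seqZ borel) (\<lambda>\<gamma>. F \<gamma> = \<phi> (r \<gamma>))"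
      by (rule standard_borel_eq_measurable[OF W_std F_meas]) measurable
    then show "Measurable.pred ?mt (\<lambda>\<gamma>. F \<gamma> = \<phi> (r \<gamma>))" by (simp only: sets_mt)
    show "(F (shiftZ \<gamma>) = \<phi> (r (shiftZ \<gamma>))) = (F \<gamma> = \<phi> (r \<gamma>))" for \<gamma>
      by (simp add: F_shift r_shift[of \<phi>, OF \<phi>_shift])
  qed
  ultimately show "\<exists>\<phi>. gmap ?Er seq_act W aW \<phi> \<and> (AE \<gamma> in ?E. F \<gamma> = \<phi> (r \<gamma>))"
    by (auto simp: gmap_def)
qed

lemma (in greg_extension) rel_metric_ergodic_future:
  "rel_metric_ergodic_wrt (ergodic_components (mtilde m m1 T Ti w) shiftZ) seq_act
    (ergodic_components (distr (mtilde m m1 T Ti w) (seqN borel) restr_future) shiftN) seq_act restr_future W aW V aV q d"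
proof (rule rel_metric_ergodic_wrtI[OF restr_future_meas])
  show "\<phi> (restr_future (shiftZ \<gamma>)) = \<phi> (restr_future \<gamma>)" if "\<And>y. \<phi> (shiftN y) = \<phi> y"
    for \<phi> :: "_ \<Rightarrow> 'w" and \<gamma> :: "int \<Rightarrow> 'g"
    using that by (simp add: shiftN_restr_future[symmetric])
qed (rule future_factor)

section \<open>Exchange of past and future\<close>

definition reflect :: "(int \<Rightarrow> 'a) \<Rightarrow> int \<Rightarrow> 'a" where
  "reflect \<gamma> = (\<lambda>i. \<gamma> (- i))"

lemma reflect_reflect [simp]: "reflect (reflect \<gamma>) = \<gamma>"
  by (simp add: reflect_def)

lemma reflect_meas: "reflect \<in> seqZ borel \<rightarrow>\<^sub>M seqZ borel"
  unfolding reflect_def by (rule measurable_seqZI, rule measurable_seqZ_nth) simp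

lemma shiftZ_reflect_shiftZ: "shiftZ (reflect (shiftZ \<gamma>)) = reflect \<gamma>"
  by (simp add: shiftZ_def reflect_def)

lemma seq_act_reflect: "seq_act g (reflect \<gamma>) = reflect (seq_act g \<gamma>)"
  by (simp add: seq_act_def reflect_def)

text \<open>Index 0 belongs to the future only and is fixed by the reflection, whence the extra
  shift. Shift-invariant functions do not notice it.\<close>

lemma restr_past_reflect: "restr_past (reflect \<gamma>) = shiftN (restr_future \<gamma>)"
  by (simp add: restr_past_def reflect_def shiftN_def restr_future_def fun_eq_iff add.commute)

context greg
begin

text \<open>\<open>- w (Ti x)\<close> is the cocycle value at time -1, which generates the cocycle
  over the inverse transformation.\<close>

lemma greg_inverse: "greg m m1 Ti T (\<lambda>x. - w (Ti x))"
  by (unfold_locales) (use T_mp Ti_mp Ti_T T_Ti in \<open>simp_all\<close>)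

lemma cocycle_inverse:
  assumes x: "x \<in> space m"
  shows "cocycle Ti T (\<lambda>x. - w (Ti x)) n x = cocycle T Ti w (- n) x"
proof (cases n rule: int_cases2)
  case (nonneg k)
  interpret I: greg m m1 Ti T "\<lambda>x. - w (Ti x)" by (rule greg_inverse)
  show ?thesis unfolding nonneg I.cocycle_nonneg cocycle_nonpos by simp
next
  case (nonpos k)
  interpret I: greg m m1 Ti T "\<lambda>x. - w (Ti x)" by (rule greg_inverse)
  show ?thesis
    unfolding nonpos I.cocycle_nonpos minus_minus cocycle_nonneg
    by (simp add: Ti_T Tn_space[OF x])
qed

lemma mtilde_inverse: "mtilde m m1 Ti T (\<lambda>x. - w (Ti x)) = distr (mtilde m m1 T Ti w) (seqZ borel) reflect"
proof -
  have "distr (mtilde m m1 T Ti w) (seqZ borel) reflect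
      = distr (m \<Otimes>\<^sub>M m1) (seqZ borel) (reflect \<circ> (\<lambda>p. seq_act (snd p) (traj (fst p))))"
    unfolding mtilde_eq by (rule distr_distr[OF reflect_meas]) measurable
  also have "\<dots> = mtilde m m1 Ti T (\<lambda>x. - w (Ti x))"
    unfolding mtilde_def
    by (rule distr_cong) (auto simp: reflect_def seq_act_def traj_def cocycle_inverse space_pair_measure)
  finally show ?thesis by simp
qed

lemma mtilde_reflect: "mtilde m m1 T Ti w = distr (mtilde m m1 Ti T (\<lambda>x. - w (Ti x))) (seqZ borel) reflect"
proof -
  have r: "reflect \<in> mtilde m m1 T Ti w \<rightarrow>\<^sub>M seqZ borel"
    using reflect_meas measurable_cong_sets[OF sets_mtilde refl] by blast
  have "distr (distr (mtilde m m1 T Ti w) (seqZ borel) reflect) (seqZ borel) reflect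
      = distr (mtilde m m1 T Ti w) (seqZ borel) (reflect \<circ> reflect)"
    by (rule distr_distr[OF reflect_meas r])
  also have "\<dots> = mtilde m m1 T Ti w"
    by (simp add: comp_def distr_id2 sets_mtilde)
  finally show ?thesis unfolding mtilde_inverse by simp
qed

end

text \<open>This is \<open>future_factor\<close> for the inverse system and \<open>F\<close>
  composed with the reflection. Invariance of \<open>f\<close> and \<open>\<phi>\<close> absorbs the
  shift in \<open>restr_past_reflect\<close>.\<close>

lemma (in greg_extension) past_factor:
  assumes F: "F \<in> seqZ borel \<rightarrow>\<^sub>M W" and F_shift: "\<And>\<gamma>. F (shiftZ \<gamma>) = F \<gamma>"
    and equi: "\<And>g. AE \<gamma> in mtilde m m1 T Ti w. F (seq_act g \<gamma>) = aW g (F \<gamma>)"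
    and f: "f \<in> seqN borel \<rightarrow>\<^sub>M V" and f_shift: "\<And>y. f (shiftN y) = f y"
    and qf: "AE \<gamma> in mtilde m m1 T Ti w. q (F \<gamma>) = f (restr_past \<gamma>)"
  shows "\<exists>\<phi>\<in>seqN borel \<rightarrow>\<^sub>M W. (\<forall>y. \<phi> (shiftN y) = \<phi> y) \<and>
    (\<forall>g. AE \<gamma> in mtilde m m1 T Ti w. \<phi> (seq_act g (restr_past \<gamma>)) = aW g (\<phi> (restr_past \<gamma>))) \<and>
    (AE \<gamma> in mtilde m m1 T Ti w. F \<gamma> = \<phi> (restr_past \<gamma>))"
proof -
  let ?mt = "mtilde m m1 T Ti w"
  let ?mt' = "mtilde m m1 Ti T (\<lambda>x. - w (Ti x))"
  interpret I: greg m m1 Ti T "\<lambda>x. - w (Ti x)" by (rule greg_inverse)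
  interpret I: greg_extension m m1 Ti T "\<lambda>x. - w (Ti x)" W aW V aV q d ..
  have r: "reflect \<in> ?mt \<rightarrow>\<^sub>M seqZ borel"
    using reflect_meas measurable_cong_sets[OF sets_mtilde refl] by blast
  have r': "reflect \<in> ?mt' \<rightarrow>\<^sub>M seqZ borel"
    using reflect_meas measurable_cong_sets[OF I.sets_mtilde refl] by blast
  have toI: "AE \<gamma> in ?mt'. P (reflect \<gamma>)" if "AE \<gamma> in ?mt. P \<gamma>" for P
    by (rule AE_distrD[OF r']) (use that in \<open>simp only: mtilde_reflect[symmetric]\<close>)
  have fromI: "AE \<gamma> in ?mt. P (reflect \<gamma>)" if "AE \<gamma> in ?mt'. P \<gamma>" for P
    by (rule AE_distrD[OF r]) (use that in \<open>simp only: mtilde_inverse[symmetric]\<close>)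
  have "\<exists>\<phi>\<in>seqN borel \<rightarrow>\<^sub>M W. (\<forall>y. \<phi> (shiftN y) = \<phi> y) \<and>
    (\<forall>g. AE \<gamma> in ?mt'. \<phi> (seq_act g (restr_future \<gamma>)) = aW g (\<phi> (restr_future \<gamma>))) \<and>
    (AE \<gamma> in ?mt'. F (reflect \<gamma>) = \<phi> (restr_future \<gamma>))"
  proof (rule I.future_factor[OF _ _ _ f])
    show "(\<lambda>\<gamma>. F (reflect \<gamma>)) \<in> seqZ borel \<rightarrow>\<^sub>M W"
      by (rule measurable_compose[OF reflect_meas F])
    show "F (reflect (shiftZ \<gamma>)) = F (reflect \<gamma>)" for \<gamma>
      using F_shift[of "reflect (shiftZ \<gamma>)"] by (simp add: shiftZ_reflect_shiftZ)
    show "AE \<gamma> in ?mt'. F (reflect (seq_act g \<gamma>)) = aW g (F (reflect \<gamma>))" for g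
      using toI[OF equi[of g]] by (simp add: seq_act_reflect)
    show "AE \<gamma> in ?mt'. q (F (reflect \<gamma>)) = f (restr_future \<gamma>)"
      using toI[OF qf] by (simp add: restr_past_reflect f_shift)
  qed
  then obtain \<phi> where \<phi>: "\<phi> \<in> seqN borel \<rightarrow>\<^sub>M W" and \<phi>_shift: "\<And>y. \<phi> (shiftN y) = \<phi> y"
    and \<phi>_equi: "\<And>g. AE \<gamma> in ?mt'. \<phi> (seq_act g (restr_future \<gamma>)) = aW g (\<phi> (restr_future \<gamma>))"
    and F\<phi>: "AE \<gamma> in ?mt'. F (reflect \<gamma>) = \<phi> (restr_future \<gamma>)"
    by blast
  have past: "\<phi> (seq_act g (restr_future (reflect \<gamma>))) = \<phi> (seq_act g (restr_past \<gamma>))" for g \<gamma>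
    using restr_past_reflect[of "reflect \<gamma>"] by (simp add: seq_act_shiftN \<phi>_shift)
  have past0: "\<phi> (restr_future (reflect \<gamma>)) = \<phi> (restr_past \<gamma>)" for \<gamma>
    using past[of 0] by simp
  have "AE \<gamma> in ?mt. \<phi> (seq_act g (restr_past \<gamma>)) = aW g (\<phi> (restr_past \<gamma>))" for g
    using fromI[OF \<phi>_equi[of g]] by (simp add: past past0)
  moreover have "AE \<gamma> in ?mt. F \<gamma> = \<phi> (restr_past \<gamma>)"
    using fromI[OF F\<phi>] by (simp add: past0)
  ultimately show ?thesis using \<phi> \<phi>_shift by blast
qed

lemma (in greg_extension) rel_metric_ergodic_past:
  "rel_metric_ergodic_wrt (ergodic_components (mtilde m m1 T Ti w) shiftZ) seq_act
    (ergodic_components (distr (mtilde m m1 T Ti w) (seqN borel) restr_past) shiftN) seq_act restr_past W aW V aV q d"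
proof (rule rel_metric_ergodic_wrtI[OF restr_past_meas])
  show "\<phi> (restr_past (shiftZ \<gamma>)) = \<phi> (restr_past \<gamma>)" if "\<And>y. \<phi> (shiftN y) = \<phi> y"
    for \<phi> :: "_ \<Rightarrow> 'w" and \<gamma> :: "int \<Rightarrow> 'g"
  proof -
    have "shiftN (restr_past (shiftZ \<gamma>)) = restr_past \<gamma>"
      by (rule ext) (auto simp: shiftN_def restr_past_def shiftZ_def intro!: arg_cong[where f=\<gamma>])
    then show ?thesis using that by metis
  qed
qed (rule past_factor)

text \<open>Second countability identifies the Borel sets of the product with the product
  sigma-algebra, so continuity of the addition gives its measurability. A preimage under translation
  by \<open>g\<close> is the image under translation by \<open>- g\<close>, to which invariance of
  \<open>\<mu>\<close> applies.\<close>

lemma left_haar_equivalent_group_prob: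
  fixes \<mu> m1 :: "'g::{group_add,t2_space,second_countable_topology} measure"
  assumes grp: "lcsc_group TYPE('g)" and haar: "left_haar \<mu>" and "prob_space m1"
    and equiv: "equivalent_measures m1 \<mu>"
  shows "measurable_group_prob m1"
proof (intro measurable_group_prob.intro measurable_group_prob_axioms.intro)
  show "prob_space m1" by fact
  show sets: "sets m1 = sets borel"
    using equiv haar by (auto simp: equivalent_measures_def left_haar_def)
  have "(\<lambda>p::'g \<times> 'g. fst p + snd p) \<in> borel_measurable borel"
    using grp by (intro borel_measurable_continuous_onI) (simp add: lcsc_group_def)
  then show "(\<lambda>p::'g \<times> 'g. fst p + snd p) \<in> borel \<Otimes>\<^sub>M borel \<rightarrow>\<^sub>M borel"
    by (simp add: borel_prod)
  then have plus: "(\<lambda>p::'g \<times> 'g. fst p + snd p) \<in> borel \<Otimes>\<^sub>M borel \<rightarrow>\<^sub>M borel" .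
  show "(uminus :: 'g \<Rightarrow> 'g) \<in> borel \<rightarrow>\<^sub>M borel"
    using grp by (intro borel_measurable_continuous_onI) (simp add: lcsc_group_def)
  fix A g assume A: "A \<in> null_sets m1"
  then have A': "A \<in> sets borel" "emeasure \<mu> A = 0"
    using equiv sets by (auto simp: equivalent_measures_def null_sets_def)
  have eq: "(\<lambda>h. g + h) -` A = (\<lambda>x. - g + x) ` A"
  proof (intro equalityI subsetI)
    fix x assume "x \<in> (\<lambda>h. g + h) -` A"
    then show "x \<in> (\<lambda>x. - g + x) ` A"
      by (intro image_eqI[of _ _ "g + x"]) (auto simp: add.assoc[symmetric])
  qed (auto simp: add.assoc[symmetric])
  have "(\<lambda>h. g + h) \<in> borel \<rightarrow>\<^sub>M (borel :: 'g measure)"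
    using measurable_compose[OF measurable_Pair1'[of g borel borel] plus] by simp
  from measurable_sets[OF this A'(1)] have meas: "(\<lambda>h. g + h) -` A \<in> sets borel" by simp
  have "emeasure \<mu> ((\<lambda>h. g + h) -` A) = 0"
    using haar A' unfolding eq left_haar_def by simp
  then show "(\<lambda>h. g + h) -` A \<in> null_sets m1"
    using equiv meas sets by (auto simp: equivalent_measures_def null_sets_def)
qed

theorem theorem3p3:
  fixes m :: "'x measure" and T Ti :: "'x \<Rightarrow> 'x"
    and w :: "'x \<Rightarrow> 'g::{group_add,t2_space,second_countable_topology}"
    and \<mu> m1 :: "'g measure"
    and W :: "'w measure" and aW :: "'g \<Rightarrow> 'w \<Rightarrow> 'w"
    and V :: "'v measure" and aV :: "'g \<Rightarrow> 'v \<Rightarrow> 'v"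
    and q :: "'w \<Rightarrow> 'v" and d :: "'w \<Rightarrow> 'w \<Rightarrow> real"
  assumes std: "standard_borel m" and prob: "prob_space m"
    and T_meas: "T \<in> m \<rightarrow>\<^sub>M m" and T_mp: "distr m m T = m"
    and Ti_meas: "Ti \<in> m \<rightarrow>\<^sub>M m" and Ti_mp: "distr m m Ti = m"
    and T_inv: "\<forall>x\<in>space m. Ti (T x) = x \<and> T (Ti x) = x"
    and grp: "lcsc_group TYPE('g)"
    and haar: "left_haar \<mu>"
    and m1_prob: "prob_space m1" and m1_equiv: "equivalent_measures m1 \<mu>"
    and w_meas: "w \<in> borel_measurable m"
  defines "mt \<equiv> mtilde m m1 T Ti w"
  defines "E \<equiv> ergodic_components mt shiftZ"
    and "Eplus \<equiv> ergodic_components (distr mt (seqN borel) restr_future) shiftN"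
    and "Eminus \<equiv> ergodic_components (distr mt (seqN borel) restr_past) shiftN"
  shows "rel_metric_ergodic_wrt E seq_act Eplus seq_act restr_future W aW V aV q d
       \<and> rel_metric_ergodic_wrt E seq_act Eminus seq_act restr_past W aW V aV q d"
proof (cases "metric_extension W aW V aV q d")
  case True
  interpret greg m m1 T Ti w
  proof (rule greg.intro[OF prob left_haar_equivalent_group_prob[OF grp haar m1_prob m1_equiv]])
    show "greg_axioms m T Ti w"
      by unfold_locales (use T_meas T_mp Ti_meas Ti_mp T_inv w_meas in auto)
  qed
  interpret greg_extension m m1 T Ti w W aW V aV q d
    by unfold_locales (rule True)
  show ?thesis
    unfolding E_def Eplus_def Eminus_def mt_def
    using rel_metric_ergodic_future rel_metric_ergodic_past by blast
next
  case False
  then show ?thesis by (simp add: rel_metric_ergodic_wrt_def)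
qed

end
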